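(* Let $P:\mathbb C\to\mathbb R$ be a $\mathcal C^\infty$-smooth function satisfying: (i) $P(z)=q(|z|)$ for all $z\in\mathbb C$, where $q:[0,+\infty)\to\mathbb R$ is a function with $q(0)=0$ such that it is strictly increasing and convex on $[0,\epsilon_0)$ for some $\epsilon_0>0$; and (ii) $P$ vanishes to infinite order at $0$. Let $\Omega_P=\{(z_1,z_2)\in\mathbb C^2:\ \mathrm{Re}\,z_1+P(z_2)<0\}$. If $H=h_1(z_1,z_2)\frac{\partial}{\partial z_1}+h_2(z_1,z_2)\frac{\partial}{\partial z_2}$ with $H(0,0)=0$ is holomorphic in $\Omega_P\cap U$, $\mathcal C^\infty$-smooth in $\overline{\Omega_P}\cap U$, and tangent to $b\Omega_P\cap U$, where $U$ is a neighborhood of $(0,0)\in\mathbb C^2$, then $H=i\beta z_2\frac{\partial}{\partial z_2}$ for some $\beta\in\mathbb R$.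
   Context: $b\Omega_P$ denotes the boundary of $\Omega_P$, with defining function $\rho(z_1,z_2)=\mathrm{Re}\,z_1+P(z_2)$. A vector field $H=h_1\frac{\partial}{\partial z_1}+h_2\frac{\partial}{\partial z_2}$ is holomorphic (resp. $\mathcal C^\infty$-smooth) on a set if its coefficients $h_1,h_2$ are. $H$ is tangent to $b\Omega_P\cap U$ if its real part is tangent, i.e. $(\mathrm{Re}\,H)\rho(z)=0$ for all $z\in b\Omega_P\cap U$. "Vanishes to infinite order at $0$" means that all partial derivatives of all orders (including order $0$) vanish at $0$.
   Formalization: H = iβz₂∂/∂z₂ is asserted, with one β, near (0,0) in the closure of Ω_P and on the closure within U of each connected component of Ω_P∩U adherent to (0,0), since H is not determined on other components; if Ω_P∩U is connected this is the full claim. *)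

theory Defs
  imports "HOL-Analysis.Analysis"
begin

definition partial_deriv ::
  "'a::euclidean_space \<Rightarrow> ('a \<Rightarrow> 'b::real_normed_vector) \<Rightarrow> 'a \<Rightarrow> 'b" where
  "partial_deriv b f x = frechet_derivative f (at x) b"

fun iter_partial ::
  "'a::euclidean_space list \<Rightarrow> ('a \<Rightarrow> 'b::real_normed_vector) \<Rightarrow> 'a \<Rightarrow> 'b" where
  "iter_partial [] f = f"
| "iter_partial (b # bs) f = iter_partial bs (partial_deriv b f)"

(* Intended for open S only.  Differentiability of all iterated partial derivatives makes
   all of them continuous as well, so this is the usual real C-infinity condition. *)
definition smooth_on_open ::
  "'a::euclidean_space set \<Rightarrow> ('a \<Rightarrow> 'b::real_normed_vector) \<Rightarrow> bool" where
  "smooth_on_open S f \<longleftrightarrow>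
     (\<forall>bs \<in> lists Basis. \<forall>x\<in>S. iter_partial bs f differentiable (at x))"

(* Smoothness on an arbitrary set, used for smoothness up to the boundary:
   f is locally the restriction of a smooth function defined on an open set. *)
definition smooth_on ::
  "'a::euclidean_space set \<Rightarrow> ('a \<Rightarrow> 'b::real_normed_vector) \<Rightarrow> bool" where
  "smooth_on S f \<longleftrightarrow>
     (\<forall>x\<in>S. \<exists>W g. open W \<and> x \<in> W \<and> smooth_on_open W g \<and> (\<forall>y\<in>S \<inter> W. g y = f y))"

definition vanishes_to_infinite_order ::
  "('a::euclidean_space \<Rightarrow> 'b::real_normed_vector) \<Rightarrow> 'a \<Rightarrow> bool" where
  "vanishes_to_infinite_order f x \<longleftrightarrow> (\<forall>bs \<in> lists Basis. iter_partial bs f x = 0)"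

(* Holomorphy in two variables on an open set: the real derivative is complex linear. *)
definition holomorphic2_on ::
  "(complex \<times> complex \<Rightarrow> complex) \<Rightarrow> (complex \<times> complex) set \<Rightarrow> bool" where
  "holomorphic2_on f S \<longleftrightarrow>
     (\<forall>z\<in>S. \<exists>a b. (f has_derivative (\<lambda>w. a * fst w + b * snd w)) (at z))"

(* Wirtinger derivatives: d/dz_j = (d/dx_j - i d/dy_j)/2, d/dzbar_j = (d/dx_j + i d/dy_j)/2. *)
definition d_z1 :: "(complex \<times> complex \<Rightarrow> complex) \<Rightarrow> complex \<times> complex \<Rightarrow> complex" where
  "d_z1 f z = (partial_deriv (1, 0) f z - \<i> * partial_deriv (\<i>, 0) f z) / 2"

definition d_z2 :: "(complex \<times> complex \<Rightarrow> complex) \<Rightarrow> complex \<times> complex \<Rightarrow> complex" where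
  "d_z2 f z = (partial_deriv (0, 1) f z - \<i> * partial_deriv (0, \<i>) f z) / 2"

definition d_zbar1 :: "(complex \<times> complex \<Rightarrow> complex) \<Rightarrow> complex \<times> complex \<Rightarrow> complex" where
  "d_zbar1 f z = (partial_deriv (1, 0) f z + \<i> * partial_deriv (\<i>, 0) f z) / 2"

definition d_zbar2 :: "(complex \<times> complex \<Rightarrow> complex) \<Rightarrow> complex \<times> complex \<Rightarrow> complex" where
  "d_zbar2 f z = (partial_deriv (0, 1) f z + \<i> * partial_deriv (0, \<i>) f z) / 2"

(* Re H = (H + Hbar)/2 as a differential operator, where H = h1 d/dz1 + h2 d/dz2. *)
definition re_vector_field ::
  "(complex \<times> complex \<Rightarrow> complex) \<Rightarrow> (complex \<times> complex \<Rightarrow> complex) \<Rightarrow>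
   (complex \<times> complex \<Rightarrow> complex) \<Rightarrow> complex \<times> complex \<Rightarrow> complex" where
  "re_vector_field h1 h2 f z =
     ((h1 z * d_z1 f z + h2 z * d_z2 f z) +
      (cnj (h1 z) * d_zbar1 f z + cnj (h2 z) * d_zbar2 f z)) / 2"

definition rho :: "(complex \<Rightarrow> real) \<Rightarrow> complex \<times> complex \<Rightarrow> real" where
  "rho P z = Re (fst z) + P (snd z)"

definition Omega :: "(complex \<Rightarrow> real) \<Rightarrow> (complex \<times> complex) set" where
  "Omega P = {z. rho P z < 0}"

definition tangent_to_boundary ::
  "(complex \<Rightarrow> real) \<Rightarrow> (complex \<times> complex) set \<Rightarrow>
   (complex \<times> complex \<Rightarrow> complex) \<Rightarrow> (complex \<times> complex \<Rightarrow> complex) \<Rightarrow> bool" where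
  "tangent_to_boundary P U h1 h2 \<longleftrightarrow>
     (\<forall>z \<in> frontier (Omega P) \<inter> U. re_vector_field h1 h2 (\<lambda>w. of_real (rho P w)) z = 0)"

end

theory Submission
  imports Defs "HOL-Complex_Analysis.Complex_Analysis"
begin

text \<open>
  Let \<open>R\<close> be the inverse of \<open>q\<close> and write \<open>r = R (- Re w)\<close>, \<open>\<phi> = r q'(r)\<close>, \<open>\<psi> = q'(r) / r\<close>.
  For fixed \<open>z\<^sub>1 = w\<close> with \<open>Re w < 0\<close> the domain is the disc \<open>|z| < r\<close>, and tangency on its boundary circle
  says that the holomorphic function
  \<open>h\<^sub>1(w,z) + \<phi> (h\<^sub>2(w,z) - h\<^sub>2(w,0)) / z + \<psi> cnj (h\<^sub>2(w,0)) z\<close>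
  of \<open>z\<close> has zero real part there, hence is an imaginary constant. In each Taylor coefficient in \<open>z\<close> of order
  at least two, this is a relation \<open>a + \<phi> b = 0\<close> with \<open>a\<close>, \<open>b\<close> holomorphic in \<open>w\<close> and \<open>\<phi>\<close> a
  nonconstant real function, so \<open>a = b = 0\<close>. Thus \<open>h\<^sub>1 = a\<^sub>0 + a\<^sub>1 z\<close> and \<open>h\<^sub>2 = b\<^sub>0 + b\<^sub>1 z + b\<^sub>2 z\<^sup>2\<close> with
  \<open>Re (a\<^sub>0 + \<phi> b\<^sub>1) = 0\<close> and \<open>a\<^sub>1 + \<phi> b\<^sub>2 + \<psi> cnj b\<^sub>0 = 0\<close>.

  As \<open>Re w \<rightarrow> 0\<close>, the second relation makes \<open>a\<^sub>1\<close> and then \<open>b\<^sub>0\<close> vanish on the imaginary axis, so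
  \<open>a\<^sub>1 = b\<^sub>0 = b\<^sub>2 = 0\<close>. The first gives \<open>Re a\<^sub>0 = 0\<close> on the axis, so \<open>a\<^sub>0\<close> extends by reflection and
  \<open>Re a\<^sub>0 = O(s)\<close> with \<open>s = - Re w\<close>. Flatness of \<open>q\<close> makes \<open>s / \<phi>\<close> accumulate at \<open>0\<close>, so \<open>Re b\<^sub>1 = 0\<close>
  on the axis, and \<open>b\<^sub>1\<close> extends too. Now \<open>Re a\<^sub>0 / s = - \<phi> Re b\<^sub>1 / s \<rightarrow> 0\<close> forces \<open>a\<^sub>0' = 0\<close> on the axis,
  so \<open>a\<^sub>0 = 0\<close> and \<open>b\<^sub>1\<close> is an imaginary constant.
\<close>

subsection \<open>Functions of one complex variable\<close>

text \<open>The derivative \<open>f'\<close> satisfies \<open>Re (f' * v) = 0\<close> for all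
  \<open>v\<close>; the directions \<open>1\<close> and \<open>\<i>\<close> show that it is
  zero.\<close>

lemma constant_on_if_Re_eq_0:
  assumes f: "f holomorphic_on S" and S: "open S" "connected S"
    and Re0: "\<And>z. z \<in> S \<Longrightarrow> Re (f z) = 0"
  shows "f constant_on S"
proof (rule has_field_derivative_0_imp_constant_on[OF _ S(2,1)])
  fix z assume z: "z \<in> S"
  have D: "(f has_field_derivative deriv f z) (at z)"
    using f S(1) z by (rule holomorphic_derivI)
  hence "((\<lambda>z. Re (f z)) has_derivative (\<lambda>v. Re (deriv f z * v))) (at z)"
    by (auto simp: has_field_derivative_def intro!: derivative_eq_intros)
  moreover have "((\<lambda>z. Re (f z)) has_derivative (\<lambda>v. 0)) (at z)"
    by (rule has_derivative_transform_within_open[OF has_derivative_const S(1) z])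
       (simp add: Re0)
  ultimately have *: "(\<lambda>v. Re (deriv f z * v)) = (\<lambda>v. 0)"
    by (rule has_derivative_unique)
  have "deriv f z = 0"
    using fun_cong[OF *, of 1] fun_cong[OF *, of \<i>] by (simp add: complex_eq_iff)
  with D show "(f has_field_derivative 0) (at z)" by simp
qed

text \<open>The maximum principle for the real part, applied to \<open>f\<close> and to
  \<open>- f\<close>.\<close>

lemma holomorphic_Re_0_on_sphere:
  assumes r: "r > 0" and f: "f holomorphic_on ball a r" and cont: "continuous_on (cball a r) f"
    and Re0: "\<And>z. z \<in> sphere a r \<Longrightarrow> Re (f z) = 0"
  obtains c where "Re c = 0" "\<And>z. z \<in> ball a r \<Longrightarrow> f z = c"
proof -
  have le: "Re (g z) \<le> 0" if "z \<in> ball a r" "g holomorphic_on ball a r" "continuous_on (cball a r) g"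
    "\<And>z. z \<in> sphere a r \<Longrightarrow> Re (g z) = 0" for g z
    by (rule maximum_real_frontier[of g "cball a r"]) (use that r in auto)
  have "Re (f z) \<le> 0" "Re (- f z) \<le> 0" if "z \<in> ball a r" for z
    using le[of z f] le[of z "\<lambda>z. - f z"] that f cont Re0
    by (auto intro!: holomorphic_intros continuous_intros)
  hence Re0': "Re (f z) = 0" if "z \<in> ball a r" for z
    using that by force
  then obtain c where c: "\<And>z. z \<in> ball a r \<Longrightarrow> f z = c"
    using constant_on_if_Re_eq_0[OF f] unfolding constant_on_def by auto
  moreover have "Re c = 0" using Re0'[of a] c[of a] r by simp
  ultimately show thesis using that by blast
qed

text \<open>On the Taylor coefficient of order \<open>n\<close> the relation acts as the factor
  \<open>(2 ^ n - 2) * (2 ^ n - 4)\<close>, which is zero only for \<open>n = 1\<close> and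
  \<open>n = 2\<close>.\<close>

lemma quadratic_if_scaling_relation:
  assumes r: "r > 0" and f: "f holomorphic_on ball 0 r" and f0: "f 0 = 0"
    and rel: "\<And>z. 4 * cmod z < r \<Longrightarrow> f (4 * z) - 6 * f (2 * z) + 8 * f z = 0"
  obtains \<alpha> \<beta> where "\<And>z. z \<in> ball 0 r \<Longrightarrow> f z = \<alpha> * z + \<beta> * z\<^sup>2"
proof -
  define D where "D n = (deriv ^^ n) f 0" for n
  let ?B = "ball 0 (r/4) :: complex set"
  have hol: "(\<lambda>z. f (u * z)) holomorphic_on ?B" if "cmod u \<le> 4" for u
  proof -
    have "u * z \<in> ball 0 r" if "z \<in> ?B" for z
      using that \<open>cmod u \<le> 4\<close> mult_mono[of "cmod u" 4 "cmod z" "cmod z"] by (simp add: norm_mult)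
    hence "f \<circ> (\<lambda>z. u * z) holomorphic_on ?B"
      by (intro holomorphic_on_compose_gen[OF _ f]) (auto intro!: holomorphic_intros)
    thus ?thesis by (simp add: o_def)
  qed
  have der: "(deriv ^^ n) (\<lambda>z. f (u * z)) 0 = u ^ n * D n" if "cmod u \<le> 4" for u n
  proof -
    have "u * z \<in> ball 0 r" if "z \<in> ?B" for z
      using that \<open>cmod u \<le> 4\<close> mult_mono[of "cmod u" 4 "cmod z" "cmod z"] by (simp add: norm_mult)
    thus ?thesis
      using higher_deriv_compose_linear[OF f, of ?B 0 u n] r by (simp add: D_def)
  qed
  have "D n = 0" if n: "n \<noteq> 1" "n \<noteq> 2" for n
  proof -
    have "(deriv ^^ n) (\<lambda>z. (f (4 * z) - 6 * f (2 * z)) + 8 * f (1 * z)) 0 =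
        (deriv ^^ n) (\<lambda>z. f (4 * z) - 6 * f (2 * z)) 0 + (deriv ^^ n) (\<lambda>z. 8 * f (1 * z)) 0"
      using r by (intro higher_deriv_add[of _ ?B] holomorphic_intros hol) auto
    also have "(deriv ^^ n) (\<lambda>z. f (4 * z) - 6 * f (2 * z)) 0 =
        (deriv ^^ n) (\<lambda>z. f (4 * z)) 0 - (deriv ^^ n) (\<lambda>z. 6 * f (2 * z)) 0"
      using r by (intro higher_deriv_diff[of _ ?B] holomorphic_intros hol) auto
    also have "(deriv ^^ n) (\<lambda>z. 6 * f (2 * z)) 0 = 6 * (deriv ^^ n) (\<lambda>z. f (2 * z)) 0"
      using r by (intro higher_deriv_cmult[of _ ?B] hol) auto
    also have "(deriv ^^ n) (\<lambda>z. 8 * f (1 * z)) 0 = 8 * (deriv ^^ n) (\<lambda>z. f (1 * z)) 0"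
      using r by (intro higher_deriv_cmult[of _ ?B] hol) auto
    also have "(deriv ^^ n) (\<lambda>z. (f (4 * z) - 6 * f (2 * z)) + 8 * f (1 * z)) 0 = (deriv ^^ n) (\<lambda>z. 0) 0"
    proof (rule higher_deriv_cong_ev)
      have "eventually (\<lambda>z::complex. z \<in> ?B) (nhds 0)"
        using r by (intro eventually_nhds_in_open) auto
      thus "\<forall>\<^sub>F z in nhds 0. f (4 * z) - 6 * f (2 * z) + 8 * f (1 * z) = 0"
        by eventually_elim (use rel in auto)
    qed simp
    finally have "(4 ^ n - 6 * 2 ^ n + 8) * D n = 0"
      unfolding der[of 4, simplified] der[of 2, simplified] der[of 1, simplified]
      by (simp add: D_def algebra_simps)
    moreover have "(4 ^ n - 6 * 2 ^ n + 8 :: complex) = (2 ^ n - 2) * (2 ^ n - 4)"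
    proof -
      have "(4::complex) ^ n = 2 ^ n * 2 ^ n" by (simp flip: power_mult_distrib)
      thus ?thesis by (simp add: algebra_simps)
    qed
    moreover have "(2::complex) ^ n \<noteq> 2"
    proof
      assume "(2::complex) ^ n = 2"
      hence "of_nat (2 ^ n) = (of_nat (2 ^ 1) :: complex)" by simp
      hence "(2::nat) ^ n = 2 ^ 1" by (simp only: of_nat_eq_iff)
      thus False using n by (subst (asm) power_inject_exp) auto
    qed
    moreover have "(2::complex) ^ n \<noteq> 4"
    proof
      assume "(2::complex) ^ n = 4"
      hence "of_nat (2 ^ n) = (of_nat (2 ^ 2) :: complex)" by simp
      hence "(2::nat) ^ n = 2 ^ 2" by (simp only: of_nat_eq_iff)
      thus False using n by (subst (asm) power_inject_exp) auto
    qed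
    ultimately show "D n = 0" by simp
  qed
  hence D: "D n = 0" if "n \<notin> {1, 2}" for n using that by simp
  have "f z = D 1 * z + D 2 / 2 * z\<^sup>2" if z: "z \<in> ball 0 r" for z
  proof -
    have "(\<lambda>n. D n / fact n * (z - 0) ^ n) sums f z"
      unfolding D_def by (rule holomorphic_power_series[OF f z])
    moreover have "(\<lambda>n. D n / fact n * (z - 0) ^ n) sums (\<Sum>n\<in>{1,2}. D n / fact n * (z - 0) ^ n)"
      by (rule sums_finite) (auto simp: D)
    ultimately have "f z = (\<Sum>n\<in>{1,2}. D n / fact n * (z - 0) ^ n)"
      by (rule sums_unique2)
    thus ?thesis by (simp add: fact_numeral)
  qed
  thus thesis by (rule that)
qed

text \<open>The quotient \<open>- A / B\<close> would be holomorphic and real, hence locally constant.\<close>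
lemma eq_0_if_real_multiplier_injective:
  assumes S: "open S" and A: "A holomorphic_on S" and B: "B holomorphic_on S"
    and rel: "\<And>w. w \<in> S \<Longrightarrow> A w + of_real (\<phi> (Re w)) * B w = 0"
    and inj: "inj_on \<phi> (Re ` S)" and w: "w \<in> S"
  shows "B w = 0"
proof (rule ccontr)
  assume nz: "B w \<noteq> 0"
  have "isCont B w"
    using B S w by (metis continuous_on_eq_continuous_at holomorphic_on_imp_continuous_on)
  then obtain d1 where d1: "d1 > 0" "\<And>y. dist w y < d1 \<Longrightarrow> B y \<noteq> 0"
    using nz continuous_at_avoid[of w B 0] by blast
  obtain d2 where d2: "d2 > 0" "ball w d2 \<subseteq> S"
    using S w open_contains_ball by blast
  define d where "d = min d1 d2"
  have d: "d > 0" "ball w d \<subseteq> S" "\<And>y. y \<in> ball w d \<Longrightarrow> B y \<noteq> 0"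
    using d1 d2 by (auto simp: d_def)
  \<comment> \<open>The factor \<open>\<i>\<close> makes the real quotient purely imaginary, as
    \<open>constant_on_if_Re_eq_0\<close> requires.\<close>
  define f where "f y = \<i> * (A y / B y)" for y
  have f: "f y = - \<i> * of_real (\<phi> (Re y))" if "y \<in> ball w d" for y
    using rel[of y] d(2) d(3)[OF that] that
    by (simp add: f_def field_simps subset_iff add_eq_0_iff2)
  have "f holomorphic_on ball w d"
    unfolding f_def using d by (intro holomorphic_intros holomorphic_on_subset[OF A] holomorphic_on_subset[OF B]) auto
  hence "f constant_on ball w d"
    by (rule constant_on_if_Re_eq_0) (auto simp: f)
  moreover define w' where "w' = w + of_real (d/2)"
  have w': "w' \<in> ball w d" using d by (simp add: w'_def dist_norm)
  ultimately have "f w' = f w" using d(1) unfolding constant_on_def by (metis centre_in_ball)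
  hence "\<phi> (Re w') = \<phi> (Re w)" using f[OF w'] f[of w] d(1) by simp
  hence "Re w' = Re w" using inj w w' d(2) by (auto dest!: inj_onD)
  thus False using d(1) by (simp add: w'_def)
qed

section \<open>Reflection and uniqueness on a left half disc\<close>

text \<open>Rotating the argument by \<open>\<i>\<close> carries the upper half disc to the left
  one, and multiplying the values by \<open>\<i>\<close> makes them real on the axis, so the Schwarz
  reflection principle applies.\<close>

lemma reflection_left_half_disc:
  assumes f: "f holomorphic_on ball 0 \<delta> \<inter> {w. Re w < 0}"
    and cont: "continuous_on (ball 0 \<delta> \<inter> {w. Re w \<le> 0}) f"
    and Re0: "\<And>w. w \<in> ball 0 \<delta> \<Longrightarrow> Re w = 0 \<Longrightarrow> Re (f w) = 0"
  obtains F where "F holomorphic_on ball 0 \<delta>"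
    "\<And>w. w \<in> ball 0 \<delta> \<Longrightarrow> Re w \<le> 0 \<Longrightarrow> F w = f w"
proof -
  define g where "g \<zeta> = \<i> * f (\<i> * \<zeta>)" for \<zeta>
  define G where "G \<zeta> = (if 0 \<le> Im \<zeta> then g \<zeta> else cnj (g (cnj \<zeta>)))" for \<zeta>
  have "G holomorphic_on ball 0 \<delta>"
    unfolding G_def
  proof (rule Schwarz_reflection)
    have "f \<circ> (\<lambda>\<zeta>. \<i> * \<zeta>) holomorphic_on ball 0 \<delta> \<inter> {z. 0 < Im z}"
      by (intro holomorphic_on_compose_gen[OF _ f]) (auto intro!: holomorphic_intros simp: norm_mult)
    thus "g holomorphic_on ball 0 \<delta> \<inter> {z. 0 < Im z}"
      unfolding g_def o_def by (intro holomorphic_intros)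
    have "continuous_on (ball 0 \<delta> \<inter> {z. 0 \<le> Im z}) (\<lambda>\<zeta>. f (\<i> * \<zeta>))"
      by (intro continuous_on_compose2[OF cont]) (auto intro!: continuous_intros simp: norm_mult)
    thus "continuous_on (ball 0 \<delta> \<inter> {z. 0 \<le> Im z}) g"
      unfolding g_def by (intro continuous_intros)
    show "g z \<in> \<real>" if "z \<in> ball 0 \<delta>" "z \<in> \<real>" for z
      using Re0[of "\<i> * z"] that by (auto simp: g_def complex_is_Real_iff norm_mult)
  qed (auto simp: image_subset_iff)
  hence "G \<circ> (\<lambda>w. - \<i> * w) holomorphic_on ball 0 \<delta>"
    by (intro holomorphic_on_compose_gen[where g = G and t = "ball 0 \<delta>"])
       (auto intro!: holomorphic_intros simp: norm_mult)
  hence "(\<lambda>w. - \<i> * G (- \<i> * w)) holomorphic_on ball 0 \<delta>"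
    unfolding o_def by (intro holomorphic_intros)
  moreover have "- \<i> * G (- \<i> * w) = f w" if "Re w \<le> 0" for w
    using that by (simp add: G_def g_def flip: mult.assoc)
  ultimately show thesis by (intro that)
qed

lemma left_half_disc_point:
  assumes "t \<in> ball 0 \<delta>" "Re t = 0"
  shows "\<forall>\<^sub>F s in at_right 0. t - of_real s \<in> ball 0 \<delta> \<inter> {w. Re w < 0}"
proof -
  have "\<forall>\<^sub>F s::real in at 0. t - of_real s \<in> ball 0 \<delta>"
  proof (rule topological_tendstoD[where l = t])
    show "((\<lambda>s::real. t - of_real s) \<longlongrightarrow> t) (at 0)"
      by (auto intro!: tendsto_eq_intros)
  qed (use assms in auto)
  hence "\<forall>\<^sub>F s::real in at_right 0. t - of_real s \<in> ball 0 \<delta>"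
    by (rule filter_leD[rotated]) (simp add: at_le)
  moreover have "\<forall>\<^sub>F s::real in at_right 0. s > 0" by (simp add: eventually_at_right_less)
  ultimately show ?thesis by eventually_elim (use assms in auto)
qed

lemma eq_0_if_eq_0_on_axis:
  assumes F: "F holomorphic_on ball 0 \<delta>"
    and zero: "\<And>w. w \<in> ball 0 \<delta> \<Longrightarrow> Re w = 0 \<Longrightarrow> F w = 0"
    and w: "w \<in> ball 0 \<delta>"
  shows "F w = 0"
proof (rule analytic_continuation[OF F])
  have \<delta>: "\<delta> > 0" using w by (smt (verit) ball_eq_empty empty_iff)
  show "0 islimpt {w \<in> ball 0 \<delta>. Re w = 0}"
    unfolding islimpt_approachable
  proof (intro allI impI)
    fix e :: real assume "e > 0"
    then show "\<exists>x'\<in>{w \<in> ball 0 \<delta>. Re w = 0}. x' \<noteq> 0 \<and> dist x' 0 < e"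
      using \<delta> by (intro bexI[of _ "\<i> * of_real (min (e/2) (\<delta>/2))"]) (auto simp: norm_mult)
  qed
  show "(0::complex) \<in> ball 0 \<delta>" using \<delta> by simp
qed (use zero w in auto)

lemma eq_0_if_boundary_eq_0:
  assumes f: "f holomorphic_on ball 0 \<delta> \<inter> {w. Re w < 0}"
    and cont: "continuous_on (ball 0 \<delta> \<inter> {w. Re w \<le> 0}) f"
    and zero: "\<And>w. w \<in> ball 0 \<delta> \<Longrightarrow> Re w = 0 \<Longrightarrow> f w = 0"
    and w: "w \<in> ball 0 \<delta>" "Re w \<le> 0"
  shows "f w = 0"
proof -
  obtain F where F: "F holomorphic_on ball 0 \<delta>"
    and Ff: "\<And>w. w \<in> ball 0 \<delta> \<Longrightarrow> Re w \<le> 0 \<Longrightarrow> F w = f w"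
    using reflection_left_half_disc[OF f cont] zero by auto
  have "F w = 0" by (rule eq_0_if_eq_0_on_axis[OF F _ w(1)]) (simp add: Ff zero)
  thus ?thesis using Ff w by simp
qed

text \<open>The bound depends on \<open>Re w\<close> only and tends to zero, so the extension of
  \<open>f\<close> by zero to the axis is continuous, and uniqueness from zero boundary values
  applies. This serves functions with no given boundary values.\<close>

lemma eq_0_if_boundary_tendsto_0:
  fixes f :: "complex \<Rightarrow> complex" and g :: "real \<Rightarrow> real"
  assumes f: "f holomorphic_on ball 0 \<delta> \<inter> {w. Re w < 0}"
    and bound: "\<And>w. w \<in> ball 0 \<delta> \<Longrightarrow> Re w < 0 \<Longrightarrow> cmod (f w) \<le> g (- Re w)"
    and g: "(g \<longlongrightarrow> 0) (at_right 0)"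
    and w: "w \<in> ball 0 \<delta>" "Re w < 0"
  shows "f w = 0"
proof -
  define f0 where "f0 w = (if Re w < 0 then f w else 0)" for w
  have "f0 holomorphic_on ball 0 \<delta> \<inter> {w. Re w < 0}"
    using f by (rule holomorphic_transform) (simp add: f0_def)
  moreover have "continuous_on (ball 0 \<delta> \<inter> {w. Re w \<le> 0}) f0"
    unfolding continuous_on_eq_continuous_within
  proof
    fix t assume t: "t \<in> ball 0 \<delta> \<inter> {w. Re w \<le> 0}"
    show "continuous (at t within ball 0 \<delta> \<inter> {w. Re w \<le> 0}) f0"
    proof (cases "Re t < 0")
      case True
      have op: "open (ball 0 \<delta> \<inter> {w. Re w < 0})" by (intro open_Int open_halfspace_Re_lt open_ball)
      hence "isCont f t"
        using f True t by (metis IntD1 IntI continuous_on_eq_continuous_at holomorphic_on_imp_continuous_on mem_Collect_eq)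
      moreover have "\<forall>\<^sub>F x in nhds t. f x = f0 x"
        using eventually_nhds_in_open[OF op, of t] True t by (auto simp: f0_def elim: eventually_mono)
      ultimately have "isCont f0 t" using isCont_cong by blast
      thus ?thesis by (rule continuous_at_imp_continuous_at_within)
    next
      case False
      hence t0: "Re t = 0" using t by simp
      show ?thesis
        unfolding continuous_within_eps_delta
      proof (intro allI impI)
        fix \<epsilon> :: real assume \<epsilon>: "\<epsilon> > 0"
        obtain b where b: "b > 0" "\<And>s. 0 < s \<Longrightarrow> s < b \<Longrightarrow> \<bar>g s\<bar> < \<epsilon>"
          using tendstoD[OF g \<epsilon>] unfolding eventually_at_right_field by auto
        have "dist (f0 x) (f0 t) < \<epsilon>" if x: "x \<in> ball 0 \<delta> \<inter> {w. Re w \<le> 0}" "dist x t < b" for x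
        proof (cases "Re x < 0")
          case True
          have "\<bar>Re (x - t)\<bar> < b" using x(2) abs_Re_le_cmod[of "x - t"] by (simp add: dist_norm)
          hence "\<bar>g (- Re x)\<bar> < \<epsilon>" using t0 True by (intro b) auto
          moreover have "cmod (f x) \<le> g (- Re x)" using x True by (intro bound) auto
          ultimately show ?thesis using True t0 by (simp add: f0_def)
        qed (use \<epsilon> t0 in \<open>simp add: f0_def\<close>)
        thus "\<exists>d>0. \<forall>x\<in>ball 0 \<delta> \<inter> {w. Re w \<le> 0}. dist x t < d \<longrightarrow> dist (f0 x) (f0 t) < \<epsilon>"
          using b(1) by blast
      qed
    qed
  qed
  ultimately have "f0 w = 0"
    by (rule eq_0_if_boundary_eq_0) (use w in \<open>auto simp: f0_def\<close>)
  thus ?thesis using w by (simp add: f0_def)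
qed

lemma directional_difference_quotient:
  fixes F :: "complex \<Rightarrow> complex"
  assumes "(F has_field_derivative F') (at t)" and v: "v \<noteq> 0"
  shows "((\<lambda>s::real. (F (t + of_real s * v) - F t) / of_real s) \<longlongrightarrow> F' * v) (at_right 0)"
proof -
  have "filterlim (\<lambda>s::real. of_real s * v) (at 0) (at_right 0)"
    using v by (auto simp: filterlim_at eventually_at_filter intro!: tendsto_eq_intros always_eventually)
  hence "((\<lambda>s::real. (F (t + of_real s * v) - F t) / (of_real s * v)) \<longlongrightarrow> F') (at_right 0)"
    using assms(1) unfolding DERIV_def by (rule filterlim_compose[rotated])
  hence "((\<lambda>s::real. (F (t + of_real s * v) - F t) / (of_real s * v) * v) \<longlongrightarrow> F' * v) (at_right 0)"
    by (intro tendsto_intros)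
  thus ?thesis using v by simp
qed

lemma tendsto_from_left_half_disc:
  assumes "continuous_on (ball 0 \<delta> \<inter> {w. Re w \<le> 0}) g" and t: "t \<in> ball 0 \<delta>" "Re t = 0"
  shows "((\<lambda>s. g (t - complex_of_real s)) \<longlongrightarrow> g t) (at_right 0)"
proof (rule continuous_on_tendsto_compose[OF assms(1)])
  show "((\<lambda>s. t - complex_of_real s) \<longlongrightarrow> t) (at_right 0)"
    by (auto intro!: tendsto_eq_intros)
  show "\<forall>\<^sub>F s in at_right 0. t - complex_of_real s \<in> ball 0 \<delta> \<inter> {w. Re w \<le> 0}"
    using left_half_disc_point[OF t] by (rule eventually_mono) auto
qed (use t in auto)

subsection \<open>Holomorphic functions of two variables\<close>

lemma holomorphic2_on_line:
  assumes f: "holomorphic2_on f S" and T: "open T"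
    and sub: "\<And>t. t \<in> T \<Longrightarrow> (x + t * u, y + t * v) \<in> S"
  shows "(\<lambda>t. f (x + t * u, y + t * v)) holomorphic_on T"
  unfolding holomorphic_on_open[OF T]
proof (intro ballI)
  fix t assume t: "t \<in> T"
  then obtain a b where ab: "(f has_derivative (\<lambda>w. a * fst w + b * snd w)) (at (x + t * u, y + t * v))"
    using f sub unfolding holomorphic2_on_def by meson
  have "((\<lambda>t. (x + t * u, y + t * v)) has_derivative (\<lambda>d. (d * u, d * v))) (at t)"
    by (auto intro!: derivative_eq_intros)
  from has_derivative_compose[OF this ab]
  have "((\<lambda>t. f (x + t * u, y + t * v)) has_derivative (\<lambda>d. (a * u + b * v) * d)) (at t)"
    by (simp add: algebra_simps)
  thus "\<exists>f'. ((\<lambda>t. f (x + t * u, y + t * v)) has_field_derivative f') (at t)"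
    unfolding has_field_derivative_def by blast
qed

text \<open>For subtracting the expected value \<open>\<i> * \<beta> * z\<^sub>2\<close> from
  \<open>h2\<close> before the identity theorem is used.\<close>

lemma holomorphic2_on_diff_const_mult_snd:
  assumes "holomorphic2_on f S"
  shows "holomorphic2_on (\<lambda>z. f z - c * snd z) S"
  unfolding holomorphic2_on_def
proof
  fix z assume "z \<in> S"
  then obtain a b where "(f has_derivative (\<lambda>w. a * fst w + b * snd w)) (at z)"
    using assms unfolding holomorphic2_on_def by blast
  hence "((\<lambda>z. f z - c * snd z) has_derivative (\<lambda>w. a * fst w + (b - c) * snd w)) (at z)"
    by (auto intro!: derivative_eq_intros simp: algebra_simps)
  thus "\<exists>a b. ((\<lambda>z. f z - c * snd z) has_derivative (\<lambda>w. a * fst w + b * snd w)) (at z)"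
    by blast
qed

text \<open>On the complex line through \<open>p\<close> and \<open>y\<close>, parametrized by
  \<open>g\<close> with \<open>g 0 = p\<close> and \<open>g 1 = y\<close>, the ball cuts out a
  convex set, and the identity theorem in one variable carries the zeros from \<open>0\<close> to
  \<open>1\<close>.\<close>

lemma holomorphic2_eq_0_ball:
  assumes f: "holomorphic2_on f (ball c r)" and p: "p \<in> ball c r"
    and zero: "\<forall>\<^sub>F z in nhds p. f z = 0" and y: "y \<in> ball c r"
  shows "f y = 0"
proof -
  define g where "g t = (fst p + t * (fst y - fst p), snd p + t * (snd y - snd p))" for t :: complex
  define T where "T = g -` ball c r"
  have g_cont: "continuous_on UNIV g" unfolding g_def by (intro continuous_intros)
  have T: "open T" unfolding T_def using g_cont by (intro open_vimage) auto
  have conv: "convex T"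
    unfolding convex_alt
  proof (intro ballI allI impI)
    fix s t :: complex and u :: real assume st: "s \<in> T" "t \<in> T" and u: "0 \<le> u \<and> u \<le> 1"
    have "g ((1 - u) *\<^sub>R s + u *\<^sub>R t) = (1 - u) *\<^sub>R g s + u *\<^sub>R g t"
      by (simp add: g_def prod_eq_iff algebra_simps scaleR_conv_of_real)
    moreover have "(1 - u) *\<^sub>R g s + u *\<^sub>R g t \<in> ball c r"
      using st u convexD_alt[OF convex_ball, of "g s" c r "g t" u] by (simp add: T_def)
    ultimately show "(1 - u) *\<^sub>R s + u *\<^sub>R t \<in> T" by (simp add: T_def)
  qed
  have g0: "g 0 = p" and g1: "g 1 = y" by (simp_all add: g_def)
  obtain B where B: "open B" "p \<in> B" "\<And>z. z \<in> B \<Longrightarrow> f z = 0"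
    using zero unfolding eventually_nhds by blast
  have hol: "(\<lambda>t. f (g t)) holomorphic_on T"
    unfolding g_def by (rule holomorphic2_on_line[OF f T]) (simp add: T_def g_def)
  have "f (g 1) = 0"
  proof (rule analytic_continuation_open[where s = "T \<inter> g -` B" and s' = T and f = "\<lambda>t. f (g t)" and g = "\<lambda>_. 0" and z = 1])
    show "open (T \<inter> g -` B)" using T B g_cont by (intro open_Int open_vimage)
    have "0 \<in> T \<inter> g -` B" using g0 p B by (simp add: T_def)
    thus "T \<inter> g -` B \<noteq> {}" by blast
    show "1 \<in> T" using g1 y by (simp add: T_def)
    show "connected T" using conv by (rule convex_connected)
  qed (use T hol B in auto)
  thus ?thesis by (simp add: g1)
qed

text \<open>The set \<open>Z\<close> of points near which \<open>f\<close> vanishes is open by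
  definition. It is closed in \<open>S\<close> because a ball in \<open>S\<close> about a limit
  point contains a point of \<open>Z\<close>, and the lemma for balls spreads the zeros over
  it.\<close>

lemma holomorphic2_eq_0:
  assumes f: "holomorphic2_on f S" and S: "open S" "connected S"
    and W: "open W" "W \<inter> S \<noteq> {}" and zero: "\<And>z. z \<in> W \<inter> S \<Longrightarrow> f z = 0"
    and y: "y \<in> S"
  shows "f y = 0"
proof -
  define Z where "Z = {z \<in> S. \<forall>\<^sub>F x in nhds z. f x = 0}"
  have "openin (top_of_set S) Z"
  proof -
    have "open {z. \<forall>\<^sub>F x in nhds z. f x = 0}"
      by (subst open_subopen) (simp add: eventually_nhds subset_iff, blast)
    moreover have "Z = S \<inter> {z. \<forall>\<^sub>F x in nhds z. f x = 0}" by (auto simp: Z_def)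
    ultimately show ?thesis by (metis openin_open)
  qed
  moreover have "closedin (top_of_set S) Z"
    unfolding closedin_limpt
  proof (intro conjI allI impI)
    show "Z \<subseteq> S" by (auto simp: Z_def)
    fix c assume "c islimpt Z \<and> c \<in> S"
    hence c: "c islimpt Z" "c \<in> S" by auto
    obtain r where r: "r > 0" "ball c r \<subseteq> S" using S(1) c(2) open_contains_ball by blast
    obtain p where p: "p \<in> Z" "p \<in> ball c r"
      using c(1) r(1) unfolding islimpt_approachable by (auto simp: dist_commute)
    have fb: "holomorphic2_on f (ball c r)" using f r(2) unfolding holomorphic2_on_def by blast
    have "f x = 0" if "x \<in> ball c r" for x
      by (rule holomorphic2_eq_0_ball[OF fb p(2) _ that]) (use p(1) in \<open>simp add: Z_def\<close>)
    moreover have "\<forall>\<^sub>F x in nhds c. x \<in> ball c r" using r(1) by (intro eventually_nhds_in_open) auto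
    ultimately show "c \<in> Z" using c(2) by (auto simp: Z_def elim: eventually_mono)
  qed
  moreover have "Z \<noteq> {}"
  proof -
    obtain p where "p \<in> W \<inter> S" using W(2) by blast
    moreover from this have "\<forall>\<^sub>F x in nhds p. x \<in> W \<inter> S"
      using W(1) S(1) by (intro eventually_nhds_in_open) auto
    hence "\<forall>\<^sub>F x in nhds p. f x = 0" by (rule eventually_mono) (rule zero)
    ultimately have "p \<in> Z" by (simp add: Z_def)
    thus ?thesis by blast
  qed
  ultimately have "Z = S" using S(2) unfolding connected_clopen by blast
  hence "y \<in> Z" using y by simp
  thus ?thesis unfolding Z_def by (auto dest: eventually_nhds_x_imp_x)
qed

lemma smooth_on_imp_continuous_on:
  assumes "smooth_on S f"
  shows "continuous_on S f"
  unfolding continuous_on_eq_continuous_within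
proof
  fix x assume x: "x \<in> S"
  then obtain W g where W: "open W" "x \<in> W" and g: "smooth_on_open W g"
    and fg: "\<And>y. y \<in> S \<inter> W \<Longrightarrow> g y = f y"
    using assms unfolding smooth_on_def by meson
  have "g differentiable (at x)"
    using g W(2) unfolding smooth_on_open_def by (auto dest!: bspec[of _ _ "[]"])
  hence "continuous (at x within S) g"
    using differentiable_imp_continuous_within continuous_at_imp_continuous_at_within by blast
  moreover have "\<forall>\<^sub>F y in at x within S. g y = f y"
    using W by (auto simp: eventually_at_topological intro!: exI[of _ W] fg)
  ultimately show "continuous (at x within S) f"
    using fg[of x] x W(2) unfolding continuous_within
    by (metis IntI Lim_transform_eventually)
qed

subsection \<open>Radial functions that are flat at the origin\<close>

lemma iter_partial_snoc: "iter_partial (bs @ [b]) f = partial_deriv b (iter_partial bs f)"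
  by (induction bs arbitrary: f) auto

text \<open>Along the real axis the partial derivatives in direction \<open>1\<close> are ordinary
  derivatives. In the radial case \<open>p 0\<close> extends the profile smoothly across
  \<open>0\<close>.\<close>

lemma smooth_real_restriction:
  fixes P :: "complex \<Rightarrow> real"
  assumes P: "smooth_on_open UNIV P" and flat: "vanishes_to_infinite_order P 0"
  obtains p :: "nat \<Rightarrow> real \<Rightarrow> real" where "p 0 = (\<lambda>x. P (of_real x))"
    "\<And>n x. (p n has_real_derivative p (Suc n) x) (at x)" "\<And>n. p n 0 = 0"
proof
  define p where "p n x = iter_partial (replicate n 1) P (of_real x)" for n and x :: real
  have lists: "replicate n 1 \<in> lists (Basis :: complex set)" for n
    by (auto simp: Basis_complex_def)
  show "p 0 = (\<lambda>x. P (of_real x))" by (simp add: p_def fun_eq_iff)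
  show "p n 0 = 0" for n
    using flat lists by (simp add: p_def vanishes_to_infinite_order_def)
  show "(p n has_real_derivative p (Suc n) x) (at x)" for n x
  proof -
    define f where "f = iter_partial (replicate n 1) P"
    define L where "L = frechet_derivative f (at (of_real x))"
    have "(f has_derivative L) (at (of_real x))"
      using P lists unfolding smooth_on_open_def L_def f_def by (simp flip: frechet_derivative_works)
    hence L: "(f has_derivative L) (at (complex_of_real x))" .
    have "(complex_of_real has_derivative complex_of_real) (at x)"
      using bounded_linear_of_real by (rule bounded_linear_imp_has_derivative)
    from has_derivative_compose[OF this L]
    have "((\<lambda>x. f (complex_of_real x)) has_derivative (\<lambda>d. L (of_real d))) (at x)" .
    moreover have "L (of_real d) = L 1 * d" for d
      using linear_scale[OF has_derivative_linear[OF L], of d 1] by (simp add: scaleR_conv_of_real)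
    moreover have "L 1 = p (Suc n) x"
      using iter_partial_snoc[of "replicate n 1" 1 P]
      by (simp add: p_def replicate_append_same L_def f_def partial_deriv_def)
    ultimately show ?thesis
      by (simp add: has_field_derivative_def p_def[abs_def] f_def)
  qed
qed

text \<open>All Taylor coefficients at \<open>0\<close> vanish, so only the Lagrange remainder of
  order \<open>n\<close> is left, and \<open>p n\<close> is bounded on the unit interval.\<close>

lemma infinite_order_bound:
  fixes p :: "nat \<Rightarrow> real \<Rightarrow> real"
  assumes p: "\<And>n x. (p n has_real_derivative p (Suc n) x) (at x)" and p0: "\<And>n. p n 0 = 0"
  obtains C where "\<And>x. 0 < x \<Longrightarrow> x \<le> 1 \<Longrightarrow> \<bar>p 0 x\<bar> \<le> C * x ^ n"
proof -
  have "continuous_on {0..1} (p n)"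
    using p DERIV_isCont continuous_at_imp_continuous_on by blast
  hence "bounded (p n ` {0..1})"
    by (intro compact_imp_bounded compact_continuous_image) auto
  then obtain C where C: "\<And>t. t \<in> {0..1} \<Longrightarrow> \<bar>p n t\<bar> \<le> C"
    unfolding bounded_iff by (auto simp del: atLeastAtMost_iff)
  have "\<bar>p 0 x\<bar> \<le> C * x ^ n" if x: "0 < x" "x \<le> 1" for x
  proof (cases "n = 0")
    case True
    thus ?thesis using C x by simp
  next
    case False
    obtain t where t: "0 < t" "t < x"
      and eq: "p 0 x = (\<Sum>m<n. p m 0 / fact m * x ^ m) + p n t / fact n * x ^ n"
      using Maclaurin[of x n p "p 0"] x p False by auto
    have "\<bar>p 0 x\<bar> = \<bar>p n t\<bar> / fact n * x ^ n" using x by (simp add: eq p0 abs_mult)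
    also have "\<dots> \<le> C / 1 * x ^ n"
      using C[of t] t x by (intro mult_right_mono frac_le) (auto intro: fact_ge_1 order_trans[OF abs_ge_zero])
    finally show ?thesis by simp
  qed
  thus thesis by (rule that)
qed

lemma radial_profile:
  fixes P :: "complex \<Rightarrow> real" and q :: "real \<Rightarrow> real"
  assumes P: "smooth_on_open UNIV P" and flat: "vanishes_to_infinite_order P 0"
    and radial: "\<And>z. P z = q (cmod z)"
  obtains q' where "\<And>r. r > 0 \<Longrightarrow> (q has_real_derivative q' r) (at r)"
    "((\<lambda>r. q' r / r) \<longlongrightarrow> 0) (at_right 0)"
    "\<And>n. \<exists>C. \<forall>r. 0 < r \<and> r \<le> 1 \<longrightarrow> \<bar>q r\<bar> \<le> C * r ^ n"
proof -
  obtain p where p0: "p 0 = (\<lambda>x. P (of_real x))"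
    and p: "\<And>n x. (p n has_real_derivative p (Suc n) x) (at x)" and pz: "\<And>n. p n 0 = 0"
    using smooth_real_restriction[OF P flat] by blast
  show thesis
  proof
    fix r :: real assume r: "r > 0"
    show "(q has_real_derivative p 1 r) (at r)"
    proof (rule has_field_derivative_transform_within_open[of "p 0" _ _ "{0<..}"])
      show "(p 0 has_real_derivative p 1 r) (at r)" using p[of 0] by simp
    qed (use r in \<open>auto simp: p0 radial\<close>)
  next
    \<comment> \<open>Since \<open>p 1 0 = 0\<close>, the quotient \<open>p 1 r / r\<close> is the
      difference quotient of \<open>p 1\<close> at \<open>0\<close>, with limit
      \<open>p 2 0 = 0\<close>.\<close>
    have "((\<lambda>r. p 1 r / r) \<longlongrightarrow> p 2 0) (at 0)"
      using p[of 1 0] unfolding has_field_derivative_iff by (simp add: pz numeral_2_eq_2)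
    thus "((\<lambda>r. p 1 r / r) \<longlongrightarrow> 0) (at_right 0)"
      by (simp add: pz filterlim_at_split)
  next
    fix n
    obtain C where "\<And>x. 0 < x \<Longrightarrow> x \<le> 1 \<Longrightarrow> \<bar>p 0 x\<bar> \<le> C * x ^ n"
      using infinite_order_bound[of p n] p pz by blast
    thus "\<exists>C. \<forall>r. 0 < r \<and> r \<le> 1 \<longrightarrow> \<bar>q r\<bar> \<le> C * r ^ n"
      by (intro exI[of _ C]) (auto simp: p0 radial)
  qed
qed

text \<open>If \<open>r * q' r \<le> N * q r\<close> held throughout, \<open>q r / r ^ N\<close>
  would be nonincreasing, hence bounded below by a positive constant near \<open>0\<close>, against
  \<open>q r = O(r ^ (N + 1))\<close>.\<close>

lemma flat_imp_large_log_derivative: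
  fixes q q' :: "real \<Rightarrow> real"
  assumes D: "\<And>r. 0 < r \<Longrightarrow> r < e \<Longrightarrow> (q has_real_derivative q' r) (at r)"
    and pos: "\<And>r. 0 < r \<Longrightarrow> r < e \<Longrightarrow> q r > 0" and e: "e > 0"
    and flat: "\<And>n. \<exists>C. \<forall>r. 0 < r \<and> r \<le> 1 \<longrightarrow> \<bar>q r\<bar> \<le> C * r ^ n"
  shows "\<exists>r. 0 < r \<and> r < e \<and> real N * q r < r * q' r"
proof (rule ccontr)
  assume "\<not> ?thesis"
  hence le: "r * q' r \<le> real N * q r" if "0 < r" "r < e" for r
    using that by (meson not_less)
  obtain C where C: "\<And>r. 0 < r \<Longrightarrow> r \<le> 1 \<Longrightarrow> \<bar>q r\<bar> \<le> C * r ^ Suc N"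
    using flat[of "Suc N"] by blast
  define b where "b = min 1 (e/2)"
  have b: "0 < b" "b \<le> 1" "b < e" using e by (auto simp: b_def)
  define c where "c = q b / b ^ N"
  have c: "c > 0" using pos b by (simp add: c_def)
  have qN: "c \<le> q r / r ^ N" if r: "0 < r" "r \<le> b" for r
    unfolding c_def
  proof (rule DERIV_nonpos_imp_nonincreasing[OF r(2)])
    fix x assume x: "r \<le> x" "x \<le> b"
    hence x': "0 < x" "x < e" using r b by auto
    have "((\<lambda>x. q x / x ^ N) has_real_derivative
        (q' x * x ^ N - q x * (real N * x ^ (N - 1))) / (x ^ N * x ^ N)) (at x)"
      using x' by (auto intro!: derivative_eq_intros D)
    moreover have "q' x * x ^ N - q x * (real N * x ^ (N - 1)) \<le> 0"
    proof (cases N)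
      case 0
      thus ?thesis using le[OF x'] x' by (simp add: mult_le_0_iff)
    next
      case (Suc m)
      have "x ^ m * (x * q' x) \<le> x ^ m * (real N * q x)"
        using le[OF x'] x' by (intro mult_left_mono) auto
      thus ?thesis by (simp add: Suc algebra_simps)
    qed
    ultimately show "\<exists>y. ((\<lambda>x. q x / x ^ N) has_real_derivative y) (at x) \<and> y \<le> 0"
      using x' by (intro exI conjI) (auto simp: divide_nonpos_pos)
  qed
  hence *: "c \<le> C * r" if "0 < r" "r \<le> b" for r
  proof -
    have "q r \<le> C * r ^ Suc N" using C[of r] that b by simp
    hence "q r / r ^ N \<le> C * r" using that by (simp add: field_simps)
    with qN[OF that] show ?thesis by simp
  qed
  \<comment> \<open>Small enough to give \<open>(\<bar>C\<bar> + 1) * r \<le> c / 2\<close>; the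
    summand \<open>1\<close> keeps the denominator positive.\<close>
  define r where "r = min b (c / (2 * (\<bar>C\<bar> + 1)))"
  have r: "0 < r" "r \<le> b" using b c by (auto simp: r_def)
  have "c \<le> C * r" using *[OF r] .
  also have "\<dots> \<le> (\<bar>C\<bar> + 1) * r" using r by (intro mult_right_mono) auto
  also have "\<dots> \<le> (\<bar>C\<bar> + 1) * (c / (2 * (\<bar>C\<bar> + 1)))"
    by (intro mult_left_mono) (auto simp: r_def)
  also have "\<dots> = c / 2" by (simp add: field_simps add_nonneg_eq_0_iff)
  finally show False using c by simp
qed

text \<open>The last two claims come from tangent lines: the one at \<open>r\<close>, evaluated at
  \<open>0\<close>, gives \<open>q r \<le> r * q' r\<close>; those at \<open>r\<close> and
  \<open>s\<close>, evaluated at each other's base point, give \<open>q' r \<le> q' s\<close>.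
  Strictness comes from \<open>q' r > 0\<close>.\<close>

lemma convex_strict_mono_profile:
  fixes q q' :: "real \<Rightarrow> real"
  assumes D: "\<And>r. r > 0 \<Longrightarrow> (q has_real_derivative q' r) (at r)"
    and mono: "strict_mono_on {0..<e} q" and conv: "convex_on {0..<e} q" and q0: "q 0 = 0"
  shows "\<And>r. 0 < r \<Longrightarrow> r < e \<Longrightarrow> 0 < q r"
    and "\<And>r. 0 < r \<Longrightarrow> r < e \<Longrightarrow> q r \<le> r * q' r"
    and "\<And>r s. 0 < r \<Longrightarrow> r < s \<Longrightarrow> s < e \<Longrightarrow> r * q' r < s * q' s"
proof -
  have tangent: "q' r * (x - r) \<le> q x - q r" if "0 < r" "r < e" "0 \<le> x" "x < e" for r x
    by (rule convex_on_imp_above_tangent[OF conv _ _ _ has_field_derivative_at_within[OF D]])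
       (use that in \<open>auto simp: interior_atLeastLessThan\<close>)
  show pos: "0 < q r" if "0 < r" "r < e" for r
    using strict_mono_onD[OF mono, of 0 r] that q0 by simp
  show le: "q r \<le> r * q' r" if "0 < r" "r < e" for r
    using tangent[of r 0] that q0 by (simp add: algebra_simps)
  show "r * q' r < s * q' s" if "0 < r" "r < s" "s < e" for r s
  proof -
    have "q' r * (s - r) \<le> q' s * (s - r)"
      using tangent[of r s] tangent[of s r] that by (simp add: algebra_simps)
    hence "q' r \<le> q' s" using that by simp
    moreover have "0 < q' r"
      using pos[of r] le[of r] that by (smt (verit) zero_less_mult_pos)
    ultimately have "r * q' r < s * q' r" "s * q' r \<le> s * q' s"
      using that by auto
    thus ?thesis by simp
  qed
qed

text \<open>The gradient of \<open>q (cmod z)\<close> is \<open>d * sgn z\<close>, where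
  \<open>z \<noteq> 0\<close> makes the norm differentiable. The outer factor 1/2 comes from the
  Wirtinger derivatives.\<close>

lemma re_vector_field_rho:
  assumes radial: "\<And>z. P z = q (cmod z)"
    and D: "(q has_real_derivative d) (at (cmod z))" and z: "z \<noteq> 0"
  shows "re_vector_field h1 h2 (\<lambda>w. of_real (rho P w)) (w, z) =
    of_real ((Re (h1 (w, z)) + d / cmod z * Re (cnj z * h2 (w, z))) / 2)"
proof -
  have P: "(P has_derivative (\<lambda>v. d * (v \<bullet> sgn z))) (at z)"
  proof -
    have "(cmod has_derivative (\<lambda>v. v \<bullet> sgn z)) (at z)"
      using has_derivative_norm[OF z] .
    from has_derivative_compose[OF this D[unfolded has_field_derivative_def]]
    show ?thesis using radial by (metis (no_types, lifting) ext)
  qed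
  have "(snd has_derivative snd) (at (w, z))"
    by (rule bounded_linear_imp_has_derivative[OF bounded_linear_snd])
  from has_derivative_compose[OF this, of P "\<lambda>v. d * (v \<bullet> sgn z)"] P
  have "((\<lambda>x. P (snd x)) has_derivative (\<lambda>v. d * (snd v \<bullet> sgn z))) (at (w, z))"
    by simp
  hence "((\<lambda>x. complex_of_real (rho P x)) has_derivative
      (\<lambda>v. of_real (Re (fst v) + d * (snd v \<bullet> sgn z)))) (at (w, z))"
    unfolding rho_def by (auto intro!: derivative_eq_intros)
  hence pd: "partial_deriv b (\<lambda>x. complex_of_real (rho P x)) (w, z) =
      of_real (Re (fst b) + d * (snd b \<bullet> sgn z))" for b
    unfolding partial_deriv_def by (simp flip: frechet_derivative_at)
  have sgn: "1 \<bullet> sgn z = Re z / cmod z" "\<i> \<bullet> sgn z = Im z / cmod z"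
    by (simp_all add: inner_complex_def sgn_div_norm divide_inverse mult.commute)
  show ?thesis
    unfolding re_vector_field_def d_z1_def d_z2_def d_zbar1_def d_zbar2_def pd
    by (simp add: sgn complex_eq_iff field_simps) (simp add: add_divide_distrib)
qed

lemma mem_frontier_Omega:
  assumes P: "continuous_on UNIV P" and z: "rho P z = 0"
  shows "z \<in> frontier (Omega P)"
proof -
  have "open (Omega P)"
    unfolding Omega_def rho_def
    by (intro open_Collect_less continuous_intros continuous_on_compose2[OF P]) auto
  moreover have "z \<notin> Omega P" using z by (simp add: Omega_def)
  moreover have "z \<in> closure (Omega P)"
    unfolding closure_approachable
  proof (intro allI impI)
    fix e :: real assume "e > 0"
    thus "\<exists>y\<in>Omega P. dist y z < e"
      using z by (intro bexI[of _ "(fst z - of_real (e/2), snd z)"])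
                 (auto simp: Omega_def rho_def dist_Pair_Pair dist_prod_def dist_norm)
  qed
  ultimately show ?thesis by (simp add: frontier_def interior_open)
qed

subsection \<open>Tangential vector fields near the origin\<close>

text \<open>\<open>R\<close> is the inverse of \<open>q\<close>, so that \<open>R (- Re w)\<close> is the radius of the disc
  in which the domain meets the line \<open>z\<^sub>1 = w\<close>. The function \<open>c\<close> carries the only information
  used about the smoothness of the vector field beyond continuity up to the boundary.\<close>
locale infinite_type_model =
  fixes q q' R :: "real \<Rightarrow> real" and \<delta> e M :: real
    and h1 h2 :: "complex \<times> complex \<Rightarrow> complex" and c :: "complex \<Rightarrow> complex"
  assumes pos: "\<delta> > 0" "e > 0"
    and q0: "q 0 = 0"
    and q_mono: "strict_mono_on {0..<e} q"
    and R: "\<And>s. 0 < s \<Longrightarrow> s < \<delta> \<Longrightarrow> 0 < R s" "\<And>s. 0 < s \<Longrightarrow> s < \<delta> \<Longrightarrow> R s < e"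
      "\<And>s. 0 < s \<Longrightarrow> s < \<delta> \<Longrightarrow> q (R s) = s"
    and q_le: "\<And>r. 0 < r \<Longrightarrow> r < e \<Longrightarrow> q r \<le> r * q' r"
    and rq'_mono: "\<And>r s. 0 < r \<Longrightarrow> r < s \<Longrightarrow> s < e \<Longrightarrow> r * q' r < s * q' s"
    and q'_lim: "((\<lambda>r. q' r / r) \<longlongrightarrow> 0) (at_right 0)"
    and log_deriv: "\<And>N \<eta>. 0 < \<eta> \<Longrightarrow> \<eta> \<le> e \<Longrightarrow> \<exists>r. 0 < r \<and> r < \<eta> \<and> real N * q r < r * q' r"
    and hol: "holomorphic2_on h1 {(w, z). cmod w < \<delta> \<and> cmod z < e \<and> Re w + q (cmod z) < 0}"
      "holomorphic2_on h2 {(w, z). cmod w < \<delta> \<and> cmod z < e \<and> Re w + q (cmod z) < 0}"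
    and cont: "continuous_on {(w, z). cmod w < \<delta> \<and> cmod z < e \<and> Re w + q (cmod z) \<le> 0} h1"
      "continuous_on {(w, z). cmod w < \<delta> \<and> cmod z < e \<and> Re w + q (cmod z) \<le> 0} h2"
    and tangent: "\<And>w z. cmod w < \<delta> \<Longrightarrow> cmod z < e \<Longrightarrow> z \<noteq> 0 \<Longrightarrow> Re w + q (cmod z) = 0 \<Longrightarrow>
      Re (h1 (w, z)) + q' (cmod z) / cmod z * Re (cnj z * h2 (w, z)) = 0"
    and M: "\<And>w z. cmod w < \<delta> \<Longrightarrow> cmod z < e \<Longrightarrow> Re w + q (cmod z) < 0 \<Longrightarrow> cmod (h2 (w, z)) \<le> M"
    and c: "continuous_on (ball 0 \<delta> \<inter> {w. Re w \<le> 0}) c"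
      "\<And>w. w \<in> ball 0 \<delta> \<Longrightarrow> Re w < 0 \<Longrightarrow> ((\<lambda>z. h2 (w, z)) has_field_derivative c w) (at 0)"
    and h1_0: "h1 (0, 0) = 0"
begin

section \<open>Slices of the domain, their radii and the multipliers\<close>

definition "D = {(w, z). cmod w < \<delta> \<and> cmod z < e \<and> Re w + q (cmod z) < 0}"
definition "Dc = {(w, z). cmod w < \<delta> \<and> cmod z < e \<and> Re w + q (cmod z) \<le> 0}"
definition "H = ball 0 \<delta> \<inter> {w. Re w < 0}"
text \<open>Taken as functions of \<open>s = - Re w\<close>: these are the real weights in the
  tangency condition on the circle of radius \<open>R s\<close>, and they are tied by
  \<open>\<phi> = R\<^sup>2 * \<psi>\<close>.\<close>

definition "\<phi> s = R s * q' (R s)"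
definition "\<psi> s = q' (R s) / R s"

lemma open_H: "open H"
  unfolding H_def by (intro open_Int open_halfspace_Re_lt open_ball)

lemma H_Re: "w \<in> H \<Longrightarrow> 0 < - Re w \<and> - Re w < \<delta>"
  using abs_Re_le_cmod[of w] by (auto simp: H_def)

lemma q_less_iff: "0 < s \<Longrightarrow> s < \<delta> \<Longrightarrow> 0 \<le> r \<Longrightarrow> r < e \<Longrightarrow> q r < s \<longleftrightarrow> r < R s"
  using strict_mono_on_less[OF q_mono, of r "R s"] R by fastforce

lemma q_le_iff: "0 < s \<Longrightarrow> s < \<delta> \<Longrightarrow> 0 \<le> r \<Longrightarrow> r < e \<Longrightarrow> q r \<le> s \<longleftrightarrow> r \<le> R s"
  using strict_mono_on_less[OF q_mono, of "R s" r] R by (smt (verit) atLeastLessThan_iff)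

lemma mem_D: "w \<in> H \<Longrightarrow> cmod z < R (- Re w) \<Longrightarrow> (w, z) \<in> D"
  using H_Re[of w] R[of "- Re w"] q_less_iff[of "- Re w" "cmod z"] by (simp add: D_def H_def)

lemma mem_Dc: "w \<in> H \<Longrightarrow> cmod z \<le> R (- Re w) \<Longrightarrow> (w, z) \<in> Dc"
  using H_Re[of w] R[of "- Re w"] q_le_iff[of "- Re w" "cmod z"] by (simp add: Dc_def H_def)

lemma mem_D_imp: "(w, z) \<in> D \<Longrightarrow> w \<in> H \<and> cmod z < R (- Re w)"
proof -
  assume *: "(w, z) \<in> D"
  have "0 \<le> q (cmod z)"
    using strict_mono_on_less[OF q_mono, of "cmod z" 0] * pos(2) by (simp add: D_def q0 flip: not_less)
  hence H: "w \<in> H" using * by (simp add: D_def H_def)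
  thus ?thesis
    using H_Re[OF H] q_less_iff[of "- Re w" "cmod z"] * by (simp add: D_def)
qed

lemma H_R: "w \<in> H \<Longrightarrow> 0 < R (- Re w)" "w \<in> H \<Longrightarrow> R (- Re w) < e" "w \<in> H \<Longrightarrow> q (R (- Re w)) = - Re w"
  using H_Re R by blast+

lemma R_lim: "filterlim R (at_right 0) (at_right 0)"
proof -
  have "\<forall>\<^sub>F s in at_right 0. 0 < s \<and> s < \<delta>"
    using pos(1) by (auto simp: eventually_at_right_field)
  hence *: "\<forall>\<^sub>F s in at_right 0. 0 < R s" by eventually_elim (use R in auto)
  moreover have "(R \<longlongrightarrow> 0) (at_right 0)"
  proof (rule order_tendstoI)
    fix a :: real assume a: "0 < a"
    define b where "b = min a (e/2)"
    have b: "0 < b" "b < e" "b \<le> a" using a pos by (auto simp: b_def)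
    have qb: "0 < q b" using strict_mono_on_less[OF q_mono, of 0 b] b q0 by simp
    hence "\<forall>\<^sub>F s in at_right 0. 0 < s \<and> s < \<delta> \<and> s < q b"
      using pos(1) by (auto simp: eventually_at_right_field intro!: exI[of _ "min \<delta> (q b)"])
    thus "\<forall>\<^sub>F s in at_right 0. R s < a"
      by eventually_elim (use q_le_iff[of _ b] b in force)
  next
    fix a :: real assume "a < 0"
    thus "\<forall>\<^sub>F s in at_right 0. a < R s" using * by (auto elim: eventually_mono)
  qed
  ultimately show ?thesis unfolding filterlim_at by (auto elim: eventually_mono)
qed

lemma \<psi>_lim: "(\<psi> \<longlongrightarrow> 0) (at_right 0)"
  unfolding \<psi>_def[abs_def] by (rule filterlim_compose[OF q'_lim R_lim])

lemma \<phi>_lim: "(\<phi> \<longlongrightarrow> 0) (at_right 0)"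
proof -
  have R0: "(R \<longlongrightarrow> 0) (at_right 0)" using R_lim by (simp add: filterlim_at)
  have "((\<lambda>s. R s * R s * \<psi> s) \<longlongrightarrow> 0 * 0 * 0) (at_right 0)"
    by (intro tendsto_intros R0 \<psi>_lim)
  moreover have "R s * R s * \<psi> s = \<phi> s" for s by (simp add: \<psi>_def \<phi>_def)
  ultimately show ?thesis by simp
qed

lemma s_le_\<phi>: "w \<in> H \<Longrightarrow> - Re w \<le> \<phi> (- Re w)"
  using q_le[of "R (- Re w)"] H_R[of w] by (simp add: \<phi>_def)

lemma \<phi>_pos: "w \<in> H \<Longrightarrow> \<phi> (- Re w) > 0"
  using s_le_\<phi>[of w] H_Re[of w] by simp

lemma \<phi>_eq: "w \<in> H \<Longrightarrow> \<phi> (- Re w) = (R (- Re w))\<^sup>2 * \<psi> (- Re w)"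
  using H_R(1)[of w] by (simp add: \<phi>_def \<psi>_def power2_eq_square)

text \<open>Both \<open>R\<close> and \<open>\<lambda>r. r * q' r\<close> are strictly
  increasing.\<close>

lemma \<phi>_inj: "inj_on \<phi> {0<..<\<delta>}"
proof (rule linorder_inj_onI)
  fix s t assume "s < t" "s \<in> {0<..<\<delta>}" "t \<in> {0<..<\<delta>}"
  hence *: "0 < s" "s < \<delta>" "0 < t" "t < \<delta>" by auto
  have "R s < R t" using q_less_iff[OF *(3,4), of "R s"] R[OF *(1,2)] \<open>s < t\<close> by simp
  thus "\<phi> s \<noteq> \<phi> t"
    using rq'_mono[of "R s" "R t"] R[OF *(1,2)] R[OF *(3,4)] by (simp add: \<phi>_def)
qed auto

section \<open>Restriction to slices and expansion in \<open>z\<close>\<close>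

text \<open>The half plane is governed by a radius \<open>r\<close> instead of
  \<open>cmod z\<close>, so that the values at several points \<open>z\<close> can be combined on
  one common set of \<open>w\<close>.\<close>

lemma hol_w:
  assumes "0 \<le> r" "r < e" "cmod z \<le> r" and h: "h = h1 \<or> h = h2"
  shows "(\<lambda>w. h (w, z)) holomorphic_on ball 0 \<delta> \<inter> {w. Re w < - q r}"
proof -
  have op: "open (ball 0 \<delta> \<inter> {w. Re w < - q r})"
    by (intro open_Int open_halfspace_Re_lt open_ball)
  have "q (cmod z) \<le> q r"
    using strict_mono_on_leD[OF q_mono, of "cmod z" r] assms by simp
  hence "(\<lambda>t. h (0 + t * 1, z + t * 0)) holomorphic_on ball 0 \<delta> \<inter> {w. Re w < - q r}"
    using h hol assms by (intro holomorphic2_on_line[OF _ op, of h D]) (auto simp: D_def)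
  thus ?thesis by simp
qed

lemma hol_z:
  assumes w: "w \<in> H" and h: "h = h1 \<or> h = h2"
  shows "(\<lambda>z. h (w, z)) holomorphic_on ball 0 (R (- Re w))"
proof -
  have "(\<lambda>t. h (w + t * 0, 0 + t * 1)) holomorphic_on ball 0 (R (- Re w))"
    using h hol mem_D[OF w]
    by (intro holomorphic2_on_line[where S = D]) (auto simp: D_def)
  thus ?thesis by simp
qed

lemma hol_w_0:
  assumes h: "h = h1 \<or> h = h2"
  shows "(\<lambda>w. h (w, 0)) holomorphic_on H"
  using hol_w[of 0 0 h] h pos by (simp add: H_def q0)

lemma cont_z:
  assumes w: "w \<in> H" and h: "h = h1 \<or> h = h2"
  shows "continuous_on (cball 0 (R (- Re w))) (\<lambda>z. h (w, z))"
proof -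
  have "continuous_on Dc h" using h cont by (auto simp: Dc_def)
  thus ?thesis
    by (rule continuous_on_compose2) (use mem_Dc[OF w] in \<open>auto intro!: continuous_intros\<close>)
qed

text \<open>For fixed \<open>w\<close>, tangency says that a function holomorphic in the disc has zero real part on its
  boundary; the pole of \<open>h2 (w, z) / z\<close> is traded for the term with \<open>cnj (h2 (w, 0))\<close>.\<close>
lemma slice:
  assumes w: "w \<in> H"
  obtains \<kappa> where "Re \<kappa> = 0" "h1 (w, 0) + of_real (\<phi> (- Re w)) * c w = \<kappa>"
    "\<And>z. cmod z < R (- Re w) \<Longrightarrow>
       z * h1 (w, z) + of_real (\<phi> (- Re w)) * (h2 (w, z) - h2 (w, 0)) =
       \<kappa> * z - of_real (\<psi> (- Re w)) * cnj (h2 (w, 0)) * z\<^sup>2"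
proof -
  define s r where "s = - Re w" and "r = R s"
  have r: "r > 0" "r < e" "q r = s" using H_R[OF w] by (auto simp: s_def r_def)
  define G where "G z = h2 (w, z)" for z
  define Q where "Q z = (if z = 0 then deriv G 0 else (G z - G 0) / (z - 0))" for z
  define K where "K z = h1 (w, z) + of_real (\<phi> s) * Q z + of_real (\<psi> s) * cnj (G 0) * z" for z
  have G: "G holomorphic_on ball 0 r" "continuous_on (cball 0 r) G"
    unfolding G_def r_def s_def using hol_z[OF w] cont_z[OF w] by auto
  have Q: "Q holomorphic_on ball 0 r"
    unfolding Q_def by (rule pole_lemma[OF G(1)]) (use r in auto)
  have "continuous_on (cball 0 r) Q"
    unfolding continuous_on_eq_continuous_within
  proof
    fix z :: complex assume z: "z \<in> cball 0 r"
    show "continuous (at z within cball 0 r) Q"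
    proof (cases "z = 0")
      case True
      have "isCont Q 0"
        using Q r(1) by (metis centre_in_ball continuous_on_eq_continuous_at holomorphic_on_imp_continuous_on open_ball)
      thus ?thesis using True continuous_at_imp_continuous_at_within by blast
    next
      case False
      have "((\<lambda>z. (G z - G 0) / z) \<longlongrightarrow> (G z - G 0) / z) (at z within cball 0 r)"
        using G(2) z False by (intro tendsto_intros) (auto simp: continuous_on_def)
      moreover have "\<forall>\<^sub>F x in at z within cball 0 r. (G x - G 0) / x = Q x"
        using eventually_neq_at_within[of 0 z "cball 0 r"]
        by (rule eventually_mono) (simp add: Q_def)
      ultimately show ?thesis
        using False unfolding continuous_within by (auto simp: Q_def intro: Lim_transform_eventually)
    qed
  qed
  hence K_cont: "continuous_on (cball 0 r) K"
    unfolding K_def using cont_z[OF w, of h1]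
    by (intro continuous_intros) (auto simp: r_def s_def)
  have K_hol: "K holomorphic_on ball 0 r"
    unfolding K_def using hol_z[OF w, of h1] by (intro holomorphic_intros Q) (auto simp: r_def s_def)
  have K_Re: "Re (K z) = 0" if z: "z \<in> sphere 0 r" for z
  proof -
    have cz: "cmod z = r" "z \<noteq> 0" using z r by auto
    have "\<psi> s = q' r / r" by (simp add: \<psi>_def r_def)
    hence "Re (h1 (w, z)) + \<psi> s * Re (cnj z * G z) = 0"
      using tangent[of w z] cz w r by (simp add: H_def s_def G_def)
    \<comment> \<open>On the circle \<open>1 / z = cnj z / r\<^sup>2\<close>, which turns
      \<open>\<phi>\<close> into \<open>\<psi>\<close>.\<close>
    moreover have inv: "x / z = x * cnj z / of_real (r\<^sup>2)" for x
      using cz complex_norm_square[of z] by (simp add: field_simps)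
    have "Re (of_real (\<phi> s) * Q z) = \<psi> s * Re (cnj z * G z) - \<psi> s * Re (cnj z * G 0)"
    proof -
      have "of_real (\<phi> s) * Q z = of_real (\<phi> s / r\<^sup>2) * (cnj z * (G z - G 0))"
        using cz by (simp add: Q_def inv)
      also have "\<phi> s / r\<^sup>2 = \<psi> s" using r by (simp add: \<phi>_def \<psi>_def r_def power2_eq_square)
      finally have eq: "of_real (\<phi> s) * Q z = of_real (\<psi> s) * (cnj z * (G z - G 0))" .
      show ?thesis unfolding eq by (simp add: algebra_simps)
    qed
    \<comment> \<open>Since \<open>Re (cnj (G 0) * z) = Re (cnj z * G 0)\<close>, the compensating
      term cancels the contribution of \<open>G 0\<close>.\<close>
    moreover have "Re (of_real (\<psi> s) * cnj (G 0) * z) = \<psi> s * Re (cnj z * G 0)"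
      by (simp add: algebra_simps)
    ultimately show ?thesis unfolding K_def plus_complex.sel by linarith
  qed
  obtain \<kappa> where \<kappa>: "Re \<kappa> = 0" "\<And>z. z \<in> ball 0 r \<Longrightarrow> K z = \<kappa>"
    using holomorphic_Re_0_on_sphere[OF r(1) K_hol K_cont K_Re] by blast
  have "deriv G 0 = c w"
    unfolding G_def using c(2)[of w] w by (intro DERIV_imp_deriv) (auto simp: H_def)
  hence "h1 (w, 0) + of_real (\<phi> s) * c w = \<kappa>"
    using \<kappa>(2)[of 0] r by (simp add: K_def Q_def)
  moreover have "z * h1 (w, z) + of_real (\<phi> s) * (G z - G 0) =
       \<kappa> * z - of_real (\<psi> s) * cnj (G 0) * z\<^sup>2" if "cmod z < r" for z
  proof (cases "z = 0")
    case False
    define X where "X = (G z - G 0) / z"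
    have X: "G z - G 0 = z * X" using False by (simp add: X_def)
    have "h1 (w, z) + of_real (\<phi> s) * X + of_real (\<psi> s) * cnj (G 0) * z = \<kappa>"
      using \<kappa>(2)[of z] that False by (simp add: K_def Q_def X_def)
    hence "\<kappa> * z = (h1 (w, z) + of_real (\<phi> s) * X + of_real (\<psi> s) * cnj (G 0) * z) * z"
      by (simp only:)
    thus ?thesis unfolding X by (simp add: algebra_simps power2_eq_square)
  qed simp
  ultimately show thesis using \<kappa>(1) that[of \<kappa>] unfolding s_def r_def G_def by blast
qed

text \<open>The combination \<open>f (4 * z) - 6 * f (2 * z) + 8 * f z\<close> kills \<open>z\<close> and \<open>z\<^sup>2\<close>, hence the right-hand side
  of \<open>slice\<close>, where \<open>w\<close> enters non-holomorphically. What remains is a relation \<open>A + \<phi> B = 0\<close> between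
  holomorphic functions of \<open>w\<close>, with \<open>\<phi>\<close> an injective real function of \<open>Re w\<close>.\<close>
lemma h2_scaling_relation:
  assumes w: "w \<in> H" and z: "4 * cmod z < R (- Re w)"
  shows "(h2 (w, 4 * z) - h2 (w, 0)) - 6 * (h2 (w, 2 * z) - h2 (w, 0)) + 8 * (h2 (w, z) - h2 (w, 0)) = 0"
proof -
  define r where "r = 4 * cmod z"
  have r: "0 \<le> r" "r < e" using z H_R(2)[OF w] by (auto simp: r_def)
  \<comment> \<open>The \<open>w\<close> whose slice contains the closed disc of radius
    \<open>r = 4 * cmod z\<close>: from here on \<open>z\<close> is fixed and \<open>w\<close>
    varies.\<close>
  define S where "S = ball 0 \<delta> \<inter> {w. Re w < - q r}"
  have S_iff: "v \<in> S \<longleftrightarrow> v \<in> H \<and> r < R (- Re v)" for v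
  proof -
    have "(v, of_real r) \<in> D \<longleftrightarrow> v \<in> H \<and> r < R (- Re v)"
      using mem_D[of v "of_real r"] mem_D_imp[of v "of_real r"] r by auto
    thus ?thesis using r by (auto simp: S_def D_def)
  qed
  have hols: "(\<lambda>v. h (v, x)) holomorphic_on S" if "h = h1 \<or> h = h2" "cmod x \<le> r" for h x
    unfolding S_def by (rule hol_w[OF r that(2,1)])
  define A where "A v = 4 * z * h1 (v, 4 * z) - 6 * (2 * z * h1 (v, 2 * z)) + 8 * (z * h1 (v, z))" for v
  define B where "B v = (h2 (v, 4 * z) - h2 (v, 0)) - 6 * (h2 (v, 2 * z) - h2 (v, 0)) + 8 * (h2 (v, z) - h2 (v, 0))" for v
  have small: "cmod (4 * z) \<le> r" "cmod (2 * z) \<le> r" "cmod z \<le> r" "cmod 0 \<le> r"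
    by (simp_all add: r_def norm_mult)
  have "B w = 0"
  proof (rule eq_0_if_real_multiplier_injective[where S = S and A = A and B = B and w = w and \<phi> = "\<lambda>x. \<phi> (- x)"])
    show "open S" unfolding S_def by (intro open_Int open_halfspace_Re_lt open_ball)
    show "A holomorphic_on S" "B holomorphic_on S"
      unfolding A_def B_def by (intro holomorphic_intros hols small; simp)+
    show "inj_on (\<lambda>x. \<phi> (- x)) (Re ` S)"
      using S_iff H_Re \<phi>_inj unfolding inj_on_def by (fastforce simp: image_iff)
    show "w \<in> S" using w z S_iff by (simp add: r_def)
    fix v assume v: "v \<in> S"
    hence vH: "v \<in> H" and rv: "r < R (- Re v)" using S_iff by auto
    obtain \<kappa> where \<kappa>: "x * h1 (v, x) + of_real (\<phi> (- Re v)) * (h2 (v, x) - h2 (v, 0)) =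
       \<kappa> * x - of_real (\<psi> (- Re v)) * cnj (h2 (v, 0)) * x\<^sup>2" if "cmod x \<le> r" for x
      using slice[OF vH] rv by (metis le_less_trans)
    have "A v + of_real (\<phi> (- Re v)) * B v =
       (4 * z * h1 (v, 4 * z) + of_real (\<phi> (- Re v)) * (h2 (v, 4 * z) - h2 (v, 0)))
       - 6 * (2 * z * h1 (v, 2 * z) + of_real (\<phi> (- Re v)) * (h2 (v, 2 * z) - h2 (v, 0)))
       + 8 * (z * h1 (v, z) + of_real (\<phi> (- Re v)) * (h2 (v, z) - h2 (v, 0)))"
      by (simp add: A_def B_def algebra_simps)
    also have "\<dots> = 0"
      unfolding \<kappa>[OF small(1)] \<kappa>[OF small(2)] \<kappa>[OF small(3)] by (simp add: algebra_simps power2_eq_square)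
    finally show "A v + of_real (\<phi> (- Re v)) * B v = 0" .
  qed
  thus ?thesis by (simp add: B_def)
qed

text \<open>The scaling relation leaves a quadratic polynomial for \<open>h2\<close>, with linear
  coefficient \<open>c w\<close> by uniqueness of derivatives. Substituted into \<open>slice\<close>
  it determines \<open>h1\<close>; the constant \<open>\<kappa>\<close> is eliminated by the
  relation at \<open>z = 0\<close>.\<close>

lemma h2_quadratic:
  assumes w: "w \<in> H"
  obtains b where "\<And>z. cmod z < R (- Re w) \<Longrightarrow> h2 (w, z) = h2 (w, 0) + c w * z + b * z\<^sup>2"
    "\<And>z. cmod z < R (- Re w) \<Longrightarrow> h1 (w, z) = h1 (w, 0) -
      (of_real (\<phi> (- Re w)) * b + of_real (\<psi> (- Re w)) * cnj (h2 (w, 0))) * z"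
proof -
  define r where "r = R (- Re w)"
  have r: "r > 0" using H_R[OF w] by (simp add: r_def)
  obtain \<alpha> b where ab: "\<And>z. z \<in> ball 0 r \<Longrightarrow> h2 (w, z) - h2 (w, 0) = \<alpha> * z + b * z\<^sup>2"
  proof (rule quadratic_if_scaling_relation[OF r, of "\<lambda>z. h2 (w, z) - h2 (w, 0)"])
    show "(\<lambda>z. h2 (w, z) - h2 (w, 0)) holomorphic_on ball 0 r"
      using hol_z[OF w, of h2] by (intro holomorphic_intros) (auto simp: r_def)
  qed (use h2_scaling_relation[OF w] in \<open>auto simp: r_def\<close>)
  have eq: "h2 (w, z) = h2 (w, 0) + \<alpha> * z + b * z\<^sup>2" if "z \<in> ball 0 r" for z
    using ab[OF that] by (simp add: algebra_simps)
  have "((\<lambda>z. h2 (w, 0) + \<alpha> * z + b * z\<^sup>2) has_field_derivative \<alpha>) (at 0)"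
    by (auto intro!: derivative_eq_intros)
  hence "((\<lambda>z. h2 (w, z)) has_field_derivative \<alpha>) (at 0)"
    by (rule has_field_derivative_transform_within_open[where S = "ball 0 r"]) (use r in \<open>auto intro: eq[symmetric]\<close>)
  moreover have "((\<lambda>z. h2 (w, z)) has_field_derivative c w) (at 0)"
    using c(2)[of w] w by (simp add: H_def)
  ultimately have \<alpha>: "\<alpha> = c w" by (rule DERIV_unique)
  obtain \<kappa> where \<kappa>: "h1 (w, 0) + of_real (\<phi> (- Re w)) * c w = \<kappa>"
    "\<And>z. cmod z < r \<Longrightarrow> z * h1 (w, z) + of_real (\<phi> (- Re w)) * (h2 (w, z) - h2 (w, 0)) =
       \<kappa> * z - of_real (\<psi> (- Re w)) * cnj (h2 (w, 0)) * z\<^sup>2"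
    using slice[OF w] unfolding r_def by metis
  have "h1 (w, z) = h1 (w, 0) -
      (of_real (\<phi> (- Re w)) * b + of_real (\<psi> (- Re w)) * cnj (h2 (w, 0))) * z" if z: "cmod z < r" for z
  proof (cases "z = 0")
    case False
    have "z * h1 (w, z) = \<kappa> * z - of_real (\<psi> (- Re w)) * cnj (h2 (w, 0)) * z\<^sup>2
        - of_real (\<phi> (- Re w)) * (c w * z + b * z\<^sup>2)"
      using \<kappa>(2)[OF z] eq[of z] z by (simp add: \<alpha> algebra_simps)
    also have "\<dots> = z * (h1 (w, 0) -
      (of_real (\<phi> (- Re w)) * b + of_real (\<psi> (- Re w)) * cnj (h2 (w, 0))) * z)"
      by (simp add: \<kappa>(1)[symmetric] algebra_simps power2_eq_square)
    finally show ?thesis using False by simp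
  qed simp
  thus thesis using that[of b] eq unfolding r_def \<alpha> by simp
qed

section \<open>The slope of \<open>h1\<close> and the constant and quadratic terms of
  \<open>h2\<close> vanish\<close>

text \<open>Near a given \<open>w\<close> the slope is the difference quotient at the fixed point
  \<open>z = r\<close>, which is holomorphic in the first variable; taking half the slice radius at
  \<open>w\<close> leaves room for neighbouring slices.\<close>

lemma slope_holomorphic:
  assumes h: "h = h1 \<or> h = h2"
    and slope: "\<And>w z. w \<in> H \<Longrightarrow> cmod z < R (- Re w) \<Longrightarrow> h (w, z) = h (w, 0) + a w * z"
  shows "a holomorphic_on H"
  unfolding holomorphic_on_open[OF open_H]
proof
  fix w assume w: "w \<in> H"
  define r where "r = R (- Re w) / 2"
  have r: "0 < r" "r < e" "r < R (- Re w)" using H_R[OF w] by (auto simp: r_def)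
  define S where "S = ball 0 \<delta> \<inter> {w. Re w < - q r}"
  have op: "open S" unfolding S_def by (intro open_Int open_halfspace_Re_lt open_ball)
  have S_iff: "v \<in> S \<longleftrightarrow> v \<in> H \<and> r < R (- Re v)" for v
  proof -
    have "(v, of_real r) \<in> D \<longleftrightarrow> v \<in> H \<and> r < R (- Re v)"
      using mem_D[of v "of_real r"] mem_D_imp[of v "of_real r"] r by auto
    thus ?thesis using r by (auto simp: S_def D_def)
  qed
  have "(\<lambda>v. (h (v, of_real r) - h (v, 0)) / of_real r) holomorphic_on S"
    unfolding S_def using r h by (intro holomorphic_intros hol_w) auto
  hence "a holomorphic_on S"
  proof (rule holomorphic_transform)
    fix v assume "v \<in> S"
    hence "h (v, of_real r) = h (v, 0) + a v * of_real r" using S_iff r by (intro slope) auto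
    thus "(h (v, of_real r) - h (v, 0)) / of_real r = a v" using r by simp
  qed
  thus "\<exists>f'. (a has_field_derivative f') (at w)"
    using op w r S_iff unfolding holomorphic_on_open[OF op] by blast
qed

text \<open>Expresses \<open>b\<close> through values of \<open>h2\<close>, which are bounded and
  continuous. With \<open>x = R / 2\<close> the second difference is
  \<open>2 * b * x\<^sup>2 = b * R\<^sup>2 / 2\<close>, whence the factor 2.\<close>

lemma h2_second_difference:
  assumes w: "w \<in> H" and b: "\<And>z. cmod z < R (- Re w) \<Longrightarrow> h2 (w, z) = h2 (w, 0) + c w * z + b * z\<^sup>2"
  shows "b * of_real ((R (- Re w))\<^sup>2) =
    2 * (h2 (w, of_real (R (- Re w) / 2)) + h2 (w, - of_real (R (- Re w) / 2)) - 2 * h2 (w, 0))"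
proof -
  define x :: complex where "x = of_real (R (- Re w) / 2)"
  have x: "cmod x < R (- Re w)" "cmod (- x) < R (- Re w)"
    using H_R(1)[OF w] by (auto simp: x_def)
  have "of_real ((R (- Re w))\<^sup>2) = 4 * x\<^sup>2" by (simp add: x_def power2_eq_square)
  thus ?thesis
    unfolding x_def[symmetric] b[OF x(1)] b[OF x(2)] by (simp add: algebra_simps)
qed

text \<open>The slope of \<open>h1\<close> in \<open>z\<close> is
  \<open>- (\<phi> * b + \<psi> * cnj (h2 (w, 0)))\<close>. As
  \<open>\<phi> = R\<^sup>2 * \<psi>\<close> and \<open>R\<^sup>2 * b\<close> is bounded by
  \<open>8 * M\<close>, it is at most \<open>9 * M * \<psi>\<close>, which tends to zero at the
  axis. A holomorphic function with such a bound is zero.\<close>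

lemma h1_const:
  assumes w: "w \<in> H" and z: "cmod z < R (- Re w)"
  shows "h1 (w, z) = h1 (w, 0)"
proof -
  define a where "a w = (h1 (w, of_real (R (- Re w) / 2)) - h1 (w, 0)) / of_real (R (- Re w) / 2)" for w
  have slope: "h1 (w, z) = h1 (w, 0) + a w * z \<and> cmod (a w) \<le> 9 * M * \<psi> (- Re w)"
    if w: "w \<in> H" and z: "cmod z < R (- Re w)" for w z
  proof -
    define r where "r = R (- Re w)"
    have r: "r > 0" using H_R[OF w] by (simp add: r_def)
    obtain b where b: "\<And>z. cmod z < R (- Re w) \<Longrightarrow> h2 (w, z) = h2 (w, 0) + c w * z + b * z\<^sup>2"
      "\<And>z. cmod z < R (- Re w) \<Longrightarrow> h1 (w, z) = h1 (w, 0) -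
        (of_real (\<phi> (- Re w)) * b + of_real (\<psi> (- Re w)) * cnj (h2 (w, 0))) * z"
      using h2_quadratic[OF w] by blast
    have a: "a w = - (of_real (\<phi> (- Re w)) * b + of_real (\<psi> (- Re w)) * cnj (h2 (w, 0)))"
      using b(2)[of "of_real (R (- Re w) / 2)"] r by (simp add: a_def r_def field_simps)
    have bd: "cmod (h2 (w, z)) \<le> M" if "cmod z < r" for z
      using mem_D[OF w, of z] that M[of w z] by (simp add: D_def r_def)
    have "cmod b * r\<^sup>2 = cmod (b * of_real ((R (- Re w))\<^sup>2))"
      using r by (simp add: norm_mult r_def norm_power)
    also have "\<dots> = 2 * cmod (h2 (w, of_real (r / 2)) + h2 (w, - of_real (r / 2)) - 2 * h2 (w, 0))"
      by (subst h2_second_difference[OF w, of b]) (rule b(1), assumption, simp only: norm_mult norm_numeral r_def)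
    also have "\<dots> \<le> 2 * (cmod (h2 (w, of_real (r / 2))) + cmod (h2 (w, - of_real (r / 2))) + cmod (2 * h2 (w, 0)))"
      by (intro mult_left_mono order_trans[OF norm_triangle_ineq4] add_mono norm_triangle_ineq) auto
    also have "\<dots> \<le> 8 * M"
      using bd[of "of_real (r / 2)"] bd[of "- of_real (r / 2)"] bd[of 0] r by (simp add: norm_mult)
    finally have b_le: "cmod b * r\<^sup>2 \<le> 8 * M" .
    have \<psi>: "\<psi> (- Re w) \<ge> 0"
      using \<phi>_pos[OF w] \<phi>_eq[OF w] by (smt (verit) mult_nonneg_nonpos zero_le_power2)
    have "cmod (a w) \<le> \<phi> (- Re w) * cmod b + \<psi> (- Re w) * cmod (h2 (w, 0))"
      unfolding a norm_minus_cancel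
      by (rule order_trans[OF norm_triangle_ineq]) (use \<phi>_pos[OF w] \<psi> in \<open>simp add: norm_mult\<close>)
    also have "\<phi> (- Re w) * cmod b = \<psi> (- Re w) * (cmod b * r\<^sup>2)"
      using \<phi>_eq[OF w] by (simp add: r_def)
    also have "\<psi> (- Re w) * (cmod b * r\<^sup>2) + \<psi> (- Re w) * cmod (h2 (w, 0)) \<le> \<psi> (- Re w) * (8 * M) + \<psi> (- Re w) * M"
      using b_le bd[of 0] r \<psi> by (intro add_mono mult_left_mono) auto
    also have "\<dots> = 9 * M * \<psi> (- Re w)" by (simp add: algebra_simps)
    finally have "cmod (a w) \<le> 9 * M * \<psi> (- Re w)" .
    moreover have "h1 (w, z) = h1 (w, 0) + a w * z" unfolding b(2)[OF z] a by (simp add: algebra_simps)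
    ultimately show ?thesis by blast
  qed
  have "a holomorphic_on H" by (rule slope_holomorphic[of h1]) (use slope in blast)+
  moreover have "((\<lambda>s. 9 * M * \<psi> s) \<longlongrightarrow> 0) (at_right 0)"
    by (rule tendsto_mult_right_zero[OF \<psi>_lim])
  ultimately have "a w = 0"
    using slope[of _ 0, THEN conjunct2] H_R(1) w unfolding H_def
    by (intro eq_0_if_boundary_tendsto_0[of a \<delta> "\<lambda>s. 9 * M * \<psi> s"]) auto
  thus ?thesis using slope[OF w z] by simp
qed

lemma slice_cond:
  assumes w: "w \<in> H" and b: "\<And>z. cmod z < R (- Re w) \<Longrightarrow> h1 (w, z) = h1 (w, 0) -
        (of_real (\<phi> (- Re w)) * b + of_real (\<psi> (- Re w)) * cnj (h2 (w, 0))) * z"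
  shows "of_real ((R (- Re w))\<^sup>2) * b = - cnj (h2 (w, 0))"
proof -
  define r where "r = R (- Re w)"
  have r: "r > 0" using H_R[OF w] by (simp add: r_def)
  have "of_real (\<phi> (- Re w)) * b + of_real (\<psi> (- Re w)) * cnj (h2 (w, 0)) = 0"
    using b[of "of_real (r / 2)"] h1_const[OF w, of "of_real (r / 2)"] r by (simp add: r_def)
  hence "of_real (\<psi> (- Re w)) * (of_real ((R (- Re w))\<^sup>2) * b + cnj (h2 (w, 0))) = 0"
    by (simp add: \<phi>_eq[OF w] algebra_simps)
  moreover have "\<psi> (- Re w) \<noteq> 0" using \<phi>_eq[OF w] \<phi>_pos[OF w] by auto
  ultimately show ?thesis by (simp add: add_eq_0_iff2)
qed

text \<open>By \<open>slice_cond\<close> the conjugate of \<open>h2 (w, 0)\<close> is minus twice a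
  second difference of \<open>h2\<close> with step \<open>R / 2\<close>. The step shrinks to zero at
  the axis, and continuity up to the boundary gives the limit zero.\<close>

lemma h2_axis:
  assumes t: "t \<in> ball 0 \<delta>" "Re t = 0"
  shows "h2 (t, 0) = 0"
proof -
  define f where "f s = - 2 * (h2 (t - of_real s, of_real (R s / 2)) + h2 (t - of_real s, - of_real (R s / 2))
      - 2 * h2 (t - of_real s, 0))" for s
  have ev: "\<forall>\<^sub>F s in at_right 0. t - of_real s \<in> H" using left_half_disc_point[OF t] by (simp add: H_def)
  have "\<forall>\<^sub>F s in at_right 0. cnj (h2 (t - of_real s, 0)) = f s"
    using ev
  proof eventually_elim
    fix s :: real assume w: "t - of_real s \<in> H"
    have s: "- Re (t - of_real s) = s" using t by simp
    obtain b where b: "\<And>z. cmod z < R s \<Longrightarrow> h2 (t - of_real s, z) = h2 (t - of_real s, 0) + c (t - of_real s) * z + b * z\<^sup>2"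
      "\<And>z. cmod z < R s \<Longrightarrow> h1 (t - of_real s, z) = h1 (t - of_real s, 0) -
        (of_real (\<phi> s) * b + of_real (\<psi> s) * cnj (h2 (t - of_real s, 0))) * z"
      using h2_quadratic[OF w] unfolding s by blast
    have "of_real ((R s)\<^sup>2) * b = - cnj (h2 (t - of_real s, 0))"
      using slice_cond[OF w, of b] b(2) unfolding s by blast
    hence "cnj (h2 (t - of_real s, 0)) = - (b * of_real ((R s)\<^sup>2))"
      by (simp only: mult.commute[of b] minus_minus)
    also have "\<dots> = f s" using h2_second_difference[OF w, of b] b(1) unfolding s by (simp add: f_def)
    finally show "cnj (h2 (t - of_real s, 0)) = f s" .
  qed
  hence ev': "\<forall>\<^sub>F s in at_right 0. f s = cnj (h2 (t - of_real s, 0))" by eventually_elim simp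
  have lim_f: "(f \<longlongrightarrow> - 2 * (h2 (t, of_real (0 / 2)) + h2 (t, - of_real (0 / 2)) - 2 * h2 (t, 0))) (at_right 0)"
  proof -
    have contDc: "continuous_on Dc h2" using cont by (simp add: Dc_def)
    have tDc: "(t, 0) \<in> Dc" using t pos by (simp add: Dc_def q0)
    have R0: "(R \<longlongrightarrow> 0) (at_right 0)" using R_lim by (simp add: filterlim_at)
    have lim: "((\<lambda>s. h2 (t - of_real s, of_real (k * R s))) \<longlongrightarrow> h2 (t, 0)) (at_right 0)" if "\<bar>k\<bar> \<le> 1" for k
    proof (rule continuous_on_tendsto_compose[OF contDc _ tDc])
      show "((\<lambda>s. (t - complex_of_real s, complex_of_real (k * R s))) \<longlongrightarrow> (t, 0)) (at_right 0)"
        by (auto intro!: tendsto_eq_intros R0)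
      show "\<forall>\<^sub>F s in at_right 0. (t - complex_of_real s, complex_of_real (k * R s)) \<in> Dc"
        using ev
      proof eventually_elim
        fix s :: real assume w: "t - of_real s \<in> H"
        have s: "- Re (t - of_real s) = s" using t by simp
        have "R s > 0" using H_R(1)[OF w] by (simp only: s)
        thus "(t - complex_of_real s, complex_of_real (k * R s)) \<in> Dc"
          using that by (intro mem_Dc[OF w]) (simp only: s norm_of_real abs_mult, simp)
      qed
    qed
    show ?thesis
      unfolding f_def using lim[of "1/2"] lim[of "- 1/2"] lim[of 0] by (intro tendsto_intros) simp_all
  qed
  have lim_h: "((\<lambda>s. cnj (h2 (t - of_real s, 0))) \<longlongrightarrow> cnj (h2 (t, 0))) (at_right 0)"
  proof (intro tendsto_cnj tendsto_from_left_half_disc[OF _ t, of "\<lambda>w. h2 (w, 0)"])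
    show "continuous_on (ball 0 \<delta> \<inter> {w. Re w \<le> 0}) (\<lambda>w. h2 (w, 0))"
      by (rule continuous_on_compose2[OF cont(2)]) (use pos in \<open>auto intro!: continuous_intros simp: q0\<close>)
  qed
  have "cnj (h2 (t, 0)) = - 2 * (h2 (t, of_real (0 / 2)) + h2 (t, - of_real (0 / 2)) - 2 * h2 (t, 0))"
    by (rule tendsto_unique[OF trivial_limit_at_right_real lim_h Lim_transform_eventually[OF lim_f ev']])
  thus ?thesis by simp
qed

lemma cont_axis:
  "continuous_on (ball 0 \<delta> \<inter> {w. Re w \<le> 0}) (\<lambda>w. h1 (w, 0))"
  "continuous_on (ball 0 \<delta> \<inter> {w. Re w \<le> 0}) (\<lambda>w. h2 (w, 0))"
  by (rule continuous_on_compose2[OF cont(1)] continuous_on_compose2[OF cont(2)],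
      use pos in \<open>auto intro!: continuous_intros simp: q0\<close>)+

text \<open>\<open>h2 (w, 0)\<close> vanishes on the axis, hence for all \<open>w\<close>, and then
  \<open>slice_cond\<close> removes the quadratic term.\<close>

lemma h2_linear:
  assumes w: "w \<in> H" and z: "cmod z < R (- Re w)"
  shows "h2 (w, z) = c w * z"
proof -
  obtain b where b: "\<And>z. cmod z < R (- Re w) \<Longrightarrow> h2 (w, z) = h2 (w, 0) + c w * z + b * z\<^sup>2"
      "\<And>z. cmod z < R (- Re w) \<Longrightarrow> h1 (w, z) = h1 (w, 0) -
        (of_real (\<phi> (- Re w)) * b + of_real (\<psi> (- Re w)) * cnj (h2 (w, 0))) * z"
    using h2_quadratic[OF w] by blast
  have h0: "h2 (w, 0) = 0"
    by (rule eq_0_if_boundary_eq_0[of "\<lambda>w. h2 (w, 0)" \<delta>])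
       (use hol_w_0[of h2] cont_axis h2_axis w in \<open>auto simp: H_def\<close>)
  hence "b = 0" using slice_cond[OF w b(2)] H_R(1)[OF w] by simp
  thus ?thesis using b(1)[OF z] h0 by simp
qed

section \<open>The constant term of \<open>h1\<close> and the slope of \<open>h2\<close>\<close>

lemma Re_relation:
  assumes w: "w \<in> H"
  shows "Re (h1 (w, 0)) = - \<phi> (- Re w) * Re (c w)"
proof -
  obtain \<kappa> where "Re \<kappa> = 0" "h1 (w, 0) + of_real (\<phi> (- Re w)) * c w = \<kappa>"
    using slice[OF w] by metis
  hence "Re (h1 (w, 0) + of_real (\<phi> (- Re w)) * c w) = 0" by simp
  thus ?thesis by simp
qed

lemma c_holomorphic: "c holomorphic_on H"
  by (rule slope_holomorphic[of h2]) (use h2_linear H_R(1) in auto)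

text \<open>In \<open>Re_relation\<close> the factor \<open>\<phi>\<close> tends to zero while
  \<open>c\<close> stays continuous up to the axis.\<close>

lemma Re_h1_axis:
  assumes t: "t \<in> ball 0 \<delta>" "Re t = 0"
  shows "Re (h1 (t, 0)) = 0"
proof -
  have lim_h: "((\<lambda>s. Re (h1 (t - of_real s, 0))) \<longlongrightarrow> Re (h1 (t, 0))) (at_right 0)"
    using cont_axis by (intro tendsto_Re tendsto_from_left_half_disc[OF _ t, of "\<lambda>w. h1 (w, 0)"])
  have lim_c: "((\<lambda>s. - \<phi> s * Re (c (t - of_real s))) \<longlongrightarrow> - 0 * Re (c t)) (at_right 0)"
    using c(1) by (intro tendsto_intros \<phi>_lim tendsto_from_left_half_disc[OF _ t, of c])
  have ev: "\<forall>\<^sub>F s in at_right 0. - \<phi> s * Re (c (t - of_real s)) = Re (h1 (t - of_real s, 0))"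
    using left_half_disc_point[OF t]
  proof eventually_elim
    case (elim s)
    thus ?case using Re_relation[of "t - of_real s"] t by (simp add: H_def)
  qed
  have "Re (h1 (t, 0)) = - 0 * Re (c t)"
    by (rule tendsto_unique[OF trivial_limit_at_right_real lim_h Lim_transform_eventually[OF lim_c ev]])
  thus ?thesis by simp
qed

lemma normal_difference_quotient:
  assumes F: "F holomorphic_on ball 0 \<delta>" and t: "t \<in> ball 0 \<delta>" "Re (F t) = 0"
  shows "((\<lambda>s. Re (F (t - of_real s)) / s) \<longlongrightarrow> - Re (deriv F t)) (at_right 0)"
proof -
  have "(F has_field_derivative deriv F t) (at t)"
    using F t by (intro holomorphic_derivI[OF F]) auto
  from tendsto_Re[OF directional_difference_quotient[OF this, of "-1"]]
  show ?thesis using t by (simp add: Re_divide_of_real)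
qed

text \<open>If \<open>Re (c t) \<noteq> 0\<close>, then \<open>\<phi> s = O(s)\<close>, that is \<open>r * q' r = O(q r)\<close>,
  which bounds the order of vanishing of \<open>q\<close>.\<close>
lemma Re_c_axis:
  assumes t: "t \<in> ball 0 \<delta>" "Re t = 0"
    and F: "F holomorphic_on ball 0 \<delta>"
    and Fh: "\<And>w. w \<in> ball 0 \<delta> \<Longrightarrow> Re w \<le> 0 \<Longrightarrow> F w = h1 (w, 0)"
  shows "Re (c t) = 0"
proof (rule ccontr)
  assume nz: "Re (c t) \<noteq> 0"
  define \<epsilon> where "\<epsilon> = \<bar>Re (c t)\<bar> / 2"
  have \<epsilon>: "\<epsilon> > 0" using nz by (simp add: \<epsilon>_def)
  have "((\<lambda>s. \<bar>Re (c (t - of_real s))\<bar>) \<longlongrightarrow> \<bar>Re (c t)\<bar>) (at_right 0)"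
    using c(1) by (intro tendsto_intros tendsto_from_left_half_disc[OF _ t, of c])
  hence ev1: "\<forall>\<^sub>F s in at_right 0. \<epsilon> < \<bar>Re (c (t - of_real s))\<bar>"
    by (rule order_tendstoD) (use nz in \<open>simp add: \<epsilon>_def\<close>)
  \<comment> \<open>Bounds \<open>Re F / s\<close> along the normal at \<open>t\<close> for small
    \<open>s\<close>; the reflected \<open>F\<close> is differentiable at \<open>t\<close>.\<close>
  define K where "K = \<bar>Re (deriv F t)\<bar> + 1"
  have "Re (F t) = 0" using Fh[of t] Re_h1_axis[OF t] t by simp
  from tendsto_rabs[OF normal_difference_quotient[OF F t(1) this]]
  have ev2: "\<forall>\<^sub>F s in at_right 0. \<bar>Re (F (t - of_real s)) / s\<bar> < K"
    by (rule order_tendstoD) (simp add: K_def)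
  have "\<forall>\<^sub>F s in at_right 0. s > (0::real)" by (simp add: eventually_at_right_less)
  with ev1 ev2 left_half_disc_point[OF t] have "\<forall>\<^sub>F s in at_right 0. \<phi> s \<le> K / \<epsilon> * s"
  proof eventually_elim
    case (elim s)
    hence H: "t - of_real s \<in> H" and s: "- Re (t - of_real s) = s" using t by (auto simp: H_def)
    have "\<phi> s * \<epsilon> \<le> \<phi> s * \<bar>Re (c (t - of_real s))\<bar>"
      using elim \<phi>_pos[OF H] unfolding s by (intro mult_left_mono) auto
    also have "\<dots> = \<bar>Re (F (t - of_real s))\<bar>"
      using Re_relation[OF H] Fh[of "t - of_real s"] \<phi>_pos[OF H] elim t unfolding s by (simp add: abs_mult)
    also have "\<dots> \<le> K * s" using elim by (simp add: field_simps)
    finally show ?case using \<epsilon> by (simp add: field_simps)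
  qed
  then obtain s0 where s0: "s0 > 0" "\<And>s. 0 < s \<Longrightarrow> s < s0 \<Longrightarrow> \<phi> s \<le> K / \<epsilon> * s"
    unfolding eventually_at_right_field by auto
  define s1 where "s1 = min s0 (\<delta> / 2)"
  have s1: "0 < s1" "s1 < \<delta>" "s1 \<le> s0" using s0 pos by (auto simp: s1_def)
  \<comment> \<open>\<open>log_deriv\<close> will provide a radius \<open>r\<close>; its level
    \<open>s = q r\<close> lies below \<open>s1\<close> and satisfies \<open>R s = r\<close>, so the
    estimate for \<open>\<phi> s\<close> applies to it.\<close>
  obtain N :: nat where N: "K / \<epsilon> \<le> real N" using real_arch_simple by blast
  obtain r where r: "0 < r" "r < R s1" "real N * q r < r * q' r"
    using log_deriv[of "R s1" N] R[OF s1(1,2)] by auto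
  have re: "r < e" using r(2) R(2)[OF s1(1,2)] by simp
  have qr: "0 < q r" using strict_mono_on_less[OF q_mono, of 0 r] r re q0 by simp
  have qr': "q r < s1" using q_less_iff[OF s1(1,2), of r] r re by simp
  have "q (R (q r)) = q r" "0 < R (q r)" "R (q r) < e" using R[of "q r"] qr qr' s1 by auto
  hence "R (q r) = r"
    using strict_mono_on_eqD[OF q_mono, of "R (q r)" r] r re by simp
  hence "r * q' r \<le> K / \<epsilon> * q r" using s0(2)[of "q r"] qr qr' s1 by (simp add: \<phi>_def)
  also have "\<dots> \<le> real N * q r" using N qr by (intro mult_right_mono) auto
  finally show False using r by simp
qed

text \<open>On the axis both real parts vanish, so \<open>F\<close> and \<open>G\<close> extend
  \<open>h1 (w, 0)\<close> and \<open>c\<close> by reflection. The normal derivative gives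
  \<open>Re (deriv F t) = 0\<close> and the tangential one \<open>Im (deriv F t) = 0\<close>. So
  \<open>deriv F\<close> vanishes identically, and the constant is
  \<open>h1 (0, 0) = 0\<close>.\<close>

lemma h1_axis_eq_0:
  assumes w: "w \<in> H"
  shows "h1 (w, 0) = 0"
proof -
  obtain F where F: "F holomorphic_on ball 0 \<delta>"
    and Fh: "\<And>w. w \<in> ball 0 \<delta> \<Longrightarrow> Re w \<le> 0 \<Longrightarrow> F w = h1 (w, 0)"
  proof (rule reflection_left_half_disc)
    show "(\<lambda>w. h1 (w, 0)) holomorphic_on ball 0 \<delta> \<inter> {w. Re w < 0}"
      using hol_w_0[of h1] by (simp add: H_def)
  qed (use cont_axis(1) Re_h1_axis in auto)
  have F0: "Re (F t) = 0" if "t \<in> ball 0 \<delta>" "Re t = 0" for t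
    using Fh[of t] Re_h1_axis that by simp
  have c0: "Re (c t) = 0" if "t \<in> ball 0 \<delta>" "Re t = 0" for t
    using Re_c_axis[OF that F Fh] .
  obtain G where G: "G holomorphic_on ball 0 \<delta>"
    and Gc: "\<And>w. w \<in> ball 0 \<delta> \<Longrightarrow> Re w \<le> 0 \<Longrightarrow> G w = c w"
  proof (rule reflection_left_half_disc)
    show "c holomorphic_on ball 0 \<delta> \<inter> {w. Re w < 0}"
      using c_holomorphic by (simp add: H_def)
  qed (use c(1) c0 in auto)
  have "deriv F t = 0" if t: "t \<in> ball 0 \<delta>" "Re t = 0" for t
  proof -
    have "Re (G t) = 0" using Gc[of t] c0[of t] t by simp
    \<comment> \<open>\<open>Re G / s\<close> has a finite limit because \<open>G\<close> is
      differentiable at \<open>t\<close>; the factor \<open>\<phi>\<close> sends the product to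
      zero.\<close>
    from normal_difference_quotient[OF G t(1) this]
    have "((\<lambda>s. - \<phi> s * (Re (G (t - of_real s)) / s)) \<longlongrightarrow> - 0 * - Re (deriv G t)) (at_right 0)"
      by (intro tendsto_intros \<phi>_lim)
    moreover have "\<forall>\<^sub>F s in at_right 0. - \<phi> s * (Re (G (t - of_real s)) / s) = Re (F (t - of_real s)) / s"
      using left_half_disc_point[OF t]
    proof eventually_elim
      case (elim s)
      thus ?case using Re_relation[of "t - of_real s"] t Fh[of "t - of_real s"] Gc[of "t - of_real s"]
        by (simp add: H_def)
    qed
    ultimately have "((\<lambda>s. Re (F (t - of_real s)) / s) \<longlongrightarrow> 0) (at_right 0)"
      by (auto dest: Lim_transform_eventually)
    with normal_difference_quotient[OF F t(1) F0[OF t]] have "Re (deriv F t) = 0"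
      using tendsto_unique trivial_limit_at_right_real by fastforce
    moreover have "Im (deriv F t) = 0"
    proof -
      have D: "(F has_field_derivative deriv F t) (at t)"
        using t by (intro holomorphic_derivI[OF F]) auto
      have "((\<lambda>s. Re ((F (t + of_real s * \<i>) - F t) / of_real s)) \<longlongrightarrow> Re (deriv F t * \<i>)) (at_right 0)"
        by (intro tendsto_Re directional_difference_quotient[OF D]) auto
      moreover have "\<forall>\<^sub>F s::real in at_right 0. Re ((F (t + of_real s * \<i>) - F t) / of_real s) = 0"
      proof -
        have "((\<lambda>s::real. t + of_real s * \<i>) \<longlongrightarrow> t) (at_right 0)" by (auto intro!: tendsto_eq_intros)
        hence "\<forall>\<^sub>F s::real in at_right 0. t + of_real s * \<i> \<in> ball 0 \<delta>"
          using t by (intro topological_tendstoD) auto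
        thus ?thesis by eventually_elim (use F0 t in \<open>simp add: Re_divide_of_real\<close>)
      qed
      ultimately have "((\<lambda>s::real. 0) \<longlongrightarrow> Re (deriv F t * \<i>)) (at_right 0)"
        by (rule Lim_transform_eventually)
      thus ?thesis by (simp add: tendsto_const_iff)
    qed
    ultimately show ?thesis by (simp add: complex_eq_iff)
  qed
  hence dF: "deriv F w = 0" if "w \<in> ball 0 \<delta>" for w
    using eq_0_if_eq_0_on_axis[OF holomorphic_deriv[OF F] _ that] by auto
  have "F constant_on ball 0 \<delta>"
  proof (rule has_field_derivative_0_imp_constant_on)
    show "(F has_field_derivative 0) (at z)" if "z \<in> ball 0 \<delta>" for z
      using holomorphic_derivI[OF F _ that] dF[OF that] by simp
  qed auto
  hence "F w = F 0" using w pos unfolding constant_on_def H_def by (metis IntD1 centre_in_ball)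
  thus ?thesis using Fh[of w] Fh[of 0] w pos h1_0 by (simp add: H_def)
qed

text \<open>With \<open>h1 = 0\<close> and \<open>\<phi> > 0\<close>, \<open>Re_relation\<close>
  leaves \<open>Re (c w) = 0\<close>, so \<open>c\<close> is an imaginary constant on the connected
  set \<open>H\<close>.\<close>

lemma rotation:
  obtains \<beta> :: real where
    "\<And>w z. cmod w < \<delta> \<Longrightarrow> cmod z < e \<Longrightarrow> Re w + q (cmod z) < 0 \<Longrightarrow>
      h1 (w, z) = 0 \<and> h2 (w, z) = \<i> * of_real \<beta> * z"
proof -
  have "Re (c w) = 0" if "w \<in> H" for w
    using Re_relation[OF that] h1_axis_eq_0[OF that] \<phi>_pos[OF that] by simp
  moreover have "connected H" unfolding H_def by (intro convex_connected convex_Int convex_halfspace_Re_lt convex_ball)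
  ultimately obtain c0 where c0: "\<And>w. w \<in> H \<Longrightarrow> c w = c0"
    using constant_on_if_Re_eq_0[OF c_holomorphic open_H] unfolding constant_on_def by blast
  have "- of_real (\<delta> / 2) \<in> H" using pos by (simp add: H_def)
  hence "Re c0 = 0" using c0 \<open>\<And>w. w \<in> H \<Longrightarrow> Re (c w) = 0\<close> by metis
  hence c0': "c0 = \<i> * of_real (Im c0)" by (simp add: complex_eq_iff)
  show thesis
  proof (rule that[of "Im c0"])
    fix w z assume "cmod w < \<delta>" "cmod z < e" "Re w + q (cmod z) < 0"
    hence "w \<in> H" "cmod z < R (- Re w)" using mem_D_imp[of w z] by (auto simp: D_def)
    thus "h1 (w, z) = 0 \<and> h2 (w, z) = \<i> * of_real (Im c0) * z"
      using h1_const[of w z] h1_axis_eq_0[of w] h2_linear[of w z] c0[of w] c0' by simp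
  qed
qed

end

subsection \<open>The theorem\<close>

lemma eq_0_on_closure:
  fixes f :: "'a::metric_space \<Rightarrow> 'b::real_normed_vector"
  assumes f: "continuous_on T f" and A: "A \<subseteq> T" "\<And>x. x \<in> A \<Longrightarrow> f x = 0"
    and x: "x \<in> T" "x \<in> closure A"
  shows "f x = 0"
proof -
  obtain X where X: "\<And>n. X n \<in> A" "X \<longlonglongrightarrow> x"
    using x(2) unfolding closure_sequential by blast
  have "(\<lambda>n. f (X n)) \<longlonglongrightarrow> f x"
    by (rule continuous_on_tendsto_compose[OF f X(2) x(1)]) (use X A in \<open>auto intro!: always_eventually\<close>)
  thus ?thesis using A(2)[OF X(1)] by (simp add: LIMSEQ_const_iff)
qed

text \<open>\<open>Omega P \<inter> U\<close> need not be connected, so the formula is claimed near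
  the origin and on every component whose closure contains it, with one common
  \<open>\<beta>\<close>.\<close>

theorem theorem1:
  fixes P :: "complex \<Rightarrow> real" and q :: "real \<Rightarrow> real" and \<epsilon>0 :: real
    and h1 h2 :: "complex \<times> complex \<Rightarrow> complex" and U :: "(complex \<times> complex) set"
  assumes "smooth_on_open UNIV P"
    and "\<And>z. P z = q (cmod z)"
    and "q 0 = 0"
    and "\<epsilon>0 > 0"
    and "strict_mono_on {0..<\<epsilon>0} q"
    and "convex_on {0..<\<epsilon>0} q"
    and "vanishes_to_infinite_order P 0"
    and "open U" and "(0, 0) \<in> U"
    and "h1 (0, 0) = 0" and "h2 (0, 0) = 0"
    and "holomorphic2_on h1 (Omega P \<inter> U)" and "holomorphic2_on h2 (Omega P \<inter> U)"
    and "smooth_on (closure (Omega P) \<inter> U) h1" and "smooth_on (closure (Omega P) \<inter> U) h2"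
    and "tangent_to_boundary P U h1 h2"
  shows "\<exists>\<beta>::real.
    (\<exists>V. open V \<and> (0, 0) \<in> V \<and> V \<subseteq> U \<and>
       (\<forall>z \<in> closure (Omega P) \<inter> V. h1 z = 0 \<and> h2 z = \<i> * of_real \<beta> * snd z)) \<and>
    (\<forall>C \<in> components (Omega P \<inter> U). (0, 0) \<in> closure C \<longrightarrow>
       (\<forall>z \<in> closure C \<inter> U. h1 z = 0 \<and> h2 z = \<i> * of_real \<beta> * snd z))"
proof -

  \<comment> \<open>Boundary, continuity and profile\<close>
  note radial = assms(2)
  have P_cont: "continuous_on UNIV P"
    using assms(1) unfolding smooth_on_open_def continuous_on_eq_continuous_within
    by (auto dest!: bspec[of _ _ "[]"] intro: differentiable_imp_continuous_within)
  have Omega_open: "open (Omega P)"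
    unfolding Omega_def rho_def
    by (intro open_Collect_less continuous_intros continuous_on_compose2[OF P_cont]) auto
  have boundary: "z \<in> frontier (Omega P)" "z \<in> closure (Omega P)" if "rho P z = 0" for z
    using mem_frontier_Omega[OF P_cont that] by (auto simp: frontier_def)
  have rho_eq: "rho P (w, z) = Re w + q (cmod z)" for w z
    by (simp add: rho_def radial)
  have h_cont: "continuous_on (closure (Omega P) \<inter> U) h1" "continuous_on (closure (Omega P) \<inter> U) h2"
    by (rule smooth_on_imp_continuous_on[OF assms(14)] smooth_on_imp_continuous_on[OF assms(15)])+
  have zero_mem: "(0, 0) \<in> closure (Omega P) \<inter> U"
    using boundary(2)[of "(0, 0)"] assms(3,9) by (simp add: rho_eq)

  obtain q' where q': "\<And>r. r > 0 \<Longrightarrow> (q has_real_derivative q' r) (at r)"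
    and q'_lim: "((\<lambda>r. q' r / r) \<longlongrightarrow> 0) (at_right 0)"
    and flat: "\<And>n. \<exists>C. \<forall>r. 0 < r \<and> r \<le> 1 \<longrightarrow> \<bar>q r\<bar> \<le> C * r ^ n"
    using radial_profile[OF assms(1,7) radial] by blast
  note profile = convex_strict_mono_profile[OF q' assms(5,6,3)]

  \<comment> \<open>Choice of the polydisc\<close>
  obtain W g where W: "open W" "(0, 0) \<in> W" and g: "smooth_on_open W g"
    and gh: "\<And>y. y \<in> closure (Omega P) \<inter> U \<inter> W \<Longrightarrow> g y = h2 y"
    using assms(15) zero_mem unfolding smooth_on_def by meson
  \<comment> \<open>\<open>h2\<close> is continuous with \<open>h2 (0, 0) = 0\<close>; this provides
    the bound \<open>M = 1\<close>.\<close>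
  obtain d where d: "d > 0"
    and d_bound: "\<And>y. y \<in> closure (Omega P) \<inter> U \<Longrightarrow> dist y (0, 0) < d \<Longrightarrow> cmod (h2 y) < 1"
    using h_cont(2)[unfolded continuous_on_iff, rule_format, OF zero_mem, of 1] assms(11)
    by auto
  have "open (U \<inter> W \<inter> ball (0, 0) d)" "(0, 0) \<in> U \<inter> W \<inter> ball (0, 0) d"
    using assms(8,9) W d by auto
  then obtain \<eta> where \<eta>: "\<eta> > 0" "ball (0, 0) \<eta> \<subseteq> U \<inter> W \<inter> ball (0, 0) d"
    using open_contains_ball by blast
  have box: "(w, z) \<in> U \<inter> W \<inter> ball (0, 0) d" if "cmod w < \<eta> / 2" "cmod z < \<eta> / 2" for w z
  proof -
    have "dist (0, 0) (w, z) \<le> cmod w + cmod z"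
      using norm_Pair_le[of w z] by (simp add: dist_prod_def norm_prod_def)
    thus ?thesis using \<eta>(2) that by (auto simp: subset_iff)
  qed

  define e where "e = min (\<eta> / 2) \<epsilon>0"
  \<comment> \<open>Positive levels below \<open>q (e / 2)\<close> are attained at radii up to
    \<open>e / 2\<close>, hence below \<open>e\<close>.\<close>
  define \<delta> where "\<delta> = min (\<eta> / 2) (q (e / 2))"
  have e: "e > 0" "e \<le> \<eta> / 2" "e \<le> \<epsilon>0" using \<eta>(1) assms(4) by (auto simp: e_def)
  have \<delta>: "\<delta> > 0" "\<delta> \<le> \<eta> / 2" "\<delta> \<le> q (e / 2)"
    using \<eta>(1) e profile(1)[of "e / 2"] by (auto simp: \<delta>_def)
  have "\<exists>r. 0 < r \<and> r < e \<and> q r = s" if s: "0 < s" "s < \<delta>" for s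
  proof -
    \<comment> \<open>At \<open>0\<close> continuity of \<open>q\<close> comes from
      \<open>P\<close>, since the derivative \<open>q'\<close> is given only for positive
      radii.\<close>
    have "continuous_on {0..e / 2} (\<lambda>r. P (of_real r))"
      by (intro continuous_on_compose2[OF P_cont] continuous_intros) auto
    hence "continuous_on {0..e / 2} q"
      by (rule continuous_on_eq) (simp add: radial)
    then obtain r where "0 \<le> r" "r \<le> e / 2" "q r = s"
      using IVT'[of q 0 s "e / 2"] s \<delta> e assms(3) by auto
    thus ?thesis using s assms(3) e by (intro exI[of _ r]) (auto simp: less_le)
  qed
  then obtain R where R: "\<And>s. 0 < s \<Longrightarrow> s < \<delta> \<Longrightarrow> 0 < R s \<and> R s < e \<and> q (R s) = s"
    by metis

  define D where "D = {(w, z). cmod w < \<delta> \<and> cmod z < e \<and> Re w + q (cmod z) < 0}"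
  define Dc where "Dc = {(w, z). cmod w < \<delta> \<and> cmod z < e \<and> Re w + q (cmod z) \<le> 0}"
  \<comment> \<open>The derivative is taken of the smooth extension \<open>g\<close>, as
    \<open>h2\<close> itself need not be differentiable at boundary points. Inside the domain it is
    the complex derivative of \<open>h2\<close> in the second variable.\<close>
  define c where "c w = partial_deriv (0, 1) g (w, 0)" for w
  have D_sub: "D \<subseteq> Omega P \<inter> U"
    using box \<delta>(2) e(2) by (fastforce simp: D_def Omega_def rho_eq)
  have Dc_sub: "Dc \<subseteq> closure (Omega P) \<inter> U \<inter> W \<inter> ball (0, 0) d"
  proof
    fix x assume "x \<in> Dc"
    then obtain w z where x: "x = (w, z)" "cmod w < \<delta>" "cmod z < e" "Re w + q (cmod z) \<le> 0"
      by (auto simp: Dc_def)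
    have "x \<in> closure (Omega P)"
    proof (cases "rho P x = 0")
      case False
      hence "x \<in> Omega P" using x by (simp add: Omega_def rho_eq)
      thus ?thesis using closure_subset by blast
    qed (rule boundary)
    moreover have "x \<in> U \<inter> W \<inter> ball (0, 0) d" using x box \<delta>(2) e(2) by simp
    ultimately show "x \<in> closure (Omega P) \<inter> U \<inter> W \<inter> ball (0, 0) d" by simp
  qed

  \<comment> \<open>The hypotheses of the model\<close>
  interpret infinite_type_model q q' R \<delta> e 1 h1 h2 c
  proof
    show "strict_mono_on {0..<e} q"
      using assms(5) e unfolding strict_mono_on_def by auto
    show "\<exists>r. 0 < r \<and> r < \<eta>' \<and> real N * q r < r * q' r" if "0 < \<eta>'" "\<eta>' \<le> e" for N \<eta>'
      using that e by (intro flat_imp_large_log_derivative q' profile flat) auto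
    show "holomorphic2_on h1 {(w, z). cmod w < \<delta> \<and> cmod z < e \<and> Re w + q (cmod z) < 0}"
      "holomorphic2_on h2 {(w, z). cmod w < \<delta> \<and> cmod z < e \<and> Re w + q (cmod z) < 0}"
      using assms(12,13) D_sub unfolding holomorphic2_on_def D_def[symmetric] by blast+
    show "continuous_on {(w, z). cmod w < \<delta> \<and> cmod z < e \<and> Re w + q (cmod z) \<le> 0} h1"
      "continuous_on {(w, z). cmod w < \<delta> \<and> cmod z < e \<and> Re w + q (cmod z) \<le> 0} h2"
      unfolding Dc_def[symmetric] using Dc_sub by (auto intro: continuous_on_subset[OF h_cont(1)] continuous_on_subset[OF h_cont(2)])
    show "Re (h1 (w, z)) + q' (cmod z) / cmod z * Re (cnj z * h2 (w, z)) = 0"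
      if "cmod w < \<delta>" "cmod z < e" "z \<noteq> 0" "Re w + q (cmod z) = 0" for w z
    proof -
      have "(w, z) \<in> frontier (Omega P) \<inter> U"
        using that Dc_sub boundary(1)[of "(w, z)"] by (auto simp: Dc_def rho_eq)
      hence "re_vector_field h1 h2 (\<lambda>w. of_real (rho P w)) (w, z) = 0"
        using assms(16) unfolding tangent_to_boundary_def by blast
      moreover have "(q has_real_derivative q' (cmod z)) (at (cmod z))"
        using that by (intro q') simp
      ultimately have "complex_of_real ((Re (h1 (w, z)) + q' (cmod z) / cmod z * Re (cnj z * h2 (w, z))) / 2) = 0"
        using re_vector_field_rho[of P q, OF radial _ that(3)] by metis
      thus ?thesis unfolding of_real_eq_0_iff by simp
    qed
    show "cmod (h2 (w, z)) \<le> 1" if "cmod w < \<delta>" "cmod z < e" "Re w + q (cmod z) < 0" for w z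
    proof -
      have "(w, z) \<in> Dc" using that by (simp add: Dc_def)
      hence "(w, z) \<in> closure (Omega P) \<inter> U" "dist (w, z) (0, 0) < d"
        using subsetD[OF Dc_sub] by (simp_all add: dist_commute[of "(w, z)"])
      thus ?thesis by (rule less_imp_le[OF d_bound])
    qed
    show "continuous_on (ball 0 \<delta> \<inter> {w. Re w \<le> 0}) c"
    proof -
      have "[(0, 1)] \<in> lists (Basis :: (complex \<times> complex) set)"
        by (simp add: Basis_prod_def Basis_complex_def)
      hence "\<forall>x\<in>W. iter_partial [(0, 1)] g differentiable (at x)"
        using g unfolding smooth_on_open_def by blast
      hence "\<forall>x\<in>W. partial_deriv (0, 1) g differentiable (at x)" by simp
      hence "continuous_on W (partial_deriv (0, 1) g)"
        by (auto intro!: continuous_at_imp_continuous_on differentiable_imp_continuous_within)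
      thus ?thesis
        unfolding c_def
      proof (rule continuous_on_compose2)
        show "(\<lambda>w. (w, 0)) ` (ball 0 \<delta> \<inter> {w. Re w \<le> 0}) \<subseteq> W"
          using box \<delta>(2) \<eta>(1) by auto
      qed (intro continuous_intros)
    qed
    show "((\<lambda>z. h2 (w, z)) has_field_derivative c w) (at 0)" if w: "w \<in> ball 0 \<delta>" "Re w < 0" for w
    proof -
      have wD: "(w, 0) \<in> D" using w e assms(3) by (simp add: D_def)
      hence wS: "(w, 0) \<in> Omega P \<inter> U \<inter> W" using D_sub box[of w 0] w \<delta>(2) \<eta>(1) by auto
      obtain a b where ab: "(h2 has_derivative (\<lambda>v. a * fst v + b * snd v)) (at (w, 0))"
        using assms(13) wS unfolding holomorphic2_on_def by blast
      have "(g has_derivative (\<lambda>v. a * fst v + b * snd v)) (at (w, 0))"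
      proof (rule has_derivative_transform_within_open[OF ab _ wS])
        show "open (Omega P \<inter> U \<inter> W)" using Omega_open assms(8) W(1) by auto
        show "h2 x = g x" if "x \<in> Omega P \<inter> U \<inter> W" for x
          using gh[of x] that closure_subset[of "Omega P"] by auto
      qed
      hence "c w = b"
        unfolding c_def partial_deriv_def by (simp flip: frechet_derivative_at)
      moreover have "((\<lambda>z. (w, z)) has_derivative (\<lambda>v. (0, v))) (at 0)"
        by (auto intro!: derivative_eq_intros)
      from has_derivative_compose[OF this ab]
      have "((\<lambda>z. h2 (w, z)) has_field_derivative b) (at 0)"
        by (simp add: has_field_derivative_def)
      ultimately show ?thesis by simp
    qed
  qed (use \<delta> e R assms(3,10) profile q'_lim in auto)

  \<comment> \<open>Propagation from the polydisc\<close>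
  obtain \<beta> :: real where \<beta>: "\<And>w z. cmod w < \<delta> \<Longrightarrow> cmod z < e \<Longrightarrow> Re w + q (cmod z) < 0 \<Longrightarrow>
      h1 (w, z) = 0 \<and> h2 (w, z) = \<i> * of_real \<beta> * z"
    using rotation by blast
  define k where "k z = h2 z - \<i> * of_real \<beta> * snd z" for z
  have k_cont: "continuous_on (closure (Omega P) \<inter> U) k"
    unfolding k_def by (intro continuous_intros h_cont)
  have k_hol: "holomorphic2_on k (Omega P \<inter> U)"
    unfolding k_def by (rule holomorphic2_on_diff_const_mult_snd[OF assms(13)])
  define V :: "(complex \<times> complex) set" where "V = ball 0 \<delta> \<times> ball 0 e"
  have V: "open V" "(0, 0) \<in> V" "V \<subseteq> U"
    using \<delta> e box by (auto simp: V_def intro!: open_Times)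
  have on_V: "h1 x = 0" "k x = 0" if "x \<in> Omega P \<inter> V" for x
    using that \<beta>[of "fst x" "snd x"] by (auto simp: V_def k_def Omega_def rho_eq)
  have k_iff: "h1 z = 0 \<and> h2 z = \<i> * of_real \<beta> * snd z \<longleftrightarrow> h1 z = 0 \<and> k z = 0" for z
    by (simp add: k_def)
  have closure_0: "h1 x = 0 \<and> k x = 0"
    if "A \<subseteq> Omega P \<inter> U" "\<And>y. y \<in> A \<Longrightarrow> h1 y = 0" "\<And>y. y \<in> A \<Longrightarrow> k y = 0"
      "x \<in> closure A \<inter> U" for A x
  proof -
    have "A \<subseteq> closure (Omega P) \<inter> U" using that(1) closure_subset by blast
    moreover have "x \<in> closure (Omega P) \<inter> U" using that(1,4) closure_mono[of A "Omega P"] by blast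
    ultimately show ?thesis
      using eq_0_on_closure[OF h_cont(1)] eq_0_on_closure[OF k_cont] that(2-4) by blast
  qed
  \<comment> \<open>Since \<open>V\<close> is open, \<open>closure (Omega P) \<inter> V\<close> lies
    in \<open>closure (Omega P \<inter> V)\<close>.\<close>
  have near_0: "h1 x = 0 \<and> k x = 0" if x: "x \<in> closure (Omega P) \<inter> V" for x
  proof (rule closure_0)
    show "x \<in> closure (Omega P \<inter> V) \<inter> U"
      using x V(3) open_Int_closure_subset[OF V(1), of "Omega P"] by (auto simp: Int_commute)
  qed (use V(3) on_V in auto)
  have on_component: "h1 x = 0 \<and> k x = 0"
    if C: "C \<in> components (Omega P \<inter> U)" "(0, 0) \<in> closure C" and x: "x \<in> closure C \<inter> U" for C x
  proof (rule closure_0[OF _ _ _ x])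
    show C_sub: "C \<subseteq> Omega P \<inter> U" using C(1) by (rule in_components_subset)
    have C_open: "open C" using Omega_open assms(8) C(1) by (meson open_Int open_components)
    have C_conn: "connected C" using C(1) by (rule in_components_connected)
    \<comment> \<open>The open set \<open>V\<close> contains a point of \<open>closure C\<close>, so
      it meets \<open>C\<close>, and the identity theorem spreads the zeros over
      \<open>C\<close>.\<close>
    have VC: "V \<inter> C \<noteq> {}"
      using V C(2) by (metis IntI disjoint_iff open_Int_closure_eq_empty)
    have hol: "holomorphic2_on h1 C" "holomorphic2_on k C"
      using assms(12) k_hol C_sub unfolding holomorphic2_on_def by blast+
    show "h1 y = 0" if "y \<in> C" for y
      by (rule holomorphic2_eq_0[OF hol(1) C_open C_conn V(1) VC _ that]) (use C_sub on_V in auto)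
    show "k y = 0" if "y \<in> C" for y
      by (rule holomorphic2_eq_0[OF hol(2) C_open C_conn V(1) VC _ that]) (use C_sub on_V in auto)
  qed
  show ?thesis
  proof (intro exI[of _ \<beta>] conjI)
    show "\<exists>V. open V \<and> (0, 0) \<in> V \<and> V \<subseteq> U \<and>
      (\<forall>z \<in> closure (Omega P) \<inter> V. h1 z = 0 \<and> h2 z = \<i> * of_real \<beta> * snd z)"
      unfolding k_iff using V near_0 by blast
    show "\<forall>C \<in> components (Omega P \<inter> U). (0, 0) \<in> closure C \<longrightarrow>
       (\<forall>z \<in> closure C \<inter> U. h1 z = 0 \<and> h2 z = \<i> * of_real \<beta> * snd z)"
      unfolding k_iff using on_component by blast
  qed
qed

end
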